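(* Let $\Phi$ be a finite crystallographic root system or an untwisted affine root system. Any maximal chain in the extended weak order on $\Phi$ is the set of initial segments of a unique total ordering on the positive roots $\Phi^+$.
   Context: Root systems are (symmetrizable, crystallographic, real, reduced) root systems with base $\Pi$ and positive roots $\Phi^+=\Phi\cap\mathrm{Span}_+\Pi$ ($\mathrm{Span}_+$ = nonnegative linear combinations). Untwisted affine root systems are affinizations $\{\alpha+k\delta:\alpha\in\Phi_0,k\in\mathbb{Z}\}$ of finite irreducible root systems $\Phi_0$, imaginary roots excluded. A subset $B\subseteq\Phi^+$ is biclosed if for all $\alpha,\beta\in\Phi^+$ and $\gamma\in\mathrm{Span}_+(\alpha,\beta)\cap\Phi^+$: $\alpha,\beta\in B\Rightarrow\gamma\in B$ and $\alpha,\beta\notin B\Rightarrow\gamma\notin B$. The extended weak order is the poset of biclosed subsets of $\Phi^+$ ordered by inclusion; a maximal chain is a totally ordered family of biclosed sets that is maximal with this property. *)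

theory Defs
  imports "HOL-Analysis.Analysis"
begin

definition pos_span :: "'v::real_vector set \<Rightarrow> 'v set" where
  "pos_span S = {x. \<exists>T c. finite T \<and> T \<subseteq> S \<and> (\<forall>v\<in>T. c v \<ge> (0::real)) \<and>
                        x = (\<Sum>v\<in>T. c v *\<^sub>R v)}"

definition finite_root_system :: "'v::euclidean_space set \<Rightarrow> bool" where
  "finite_root_system \<Phi> \<longleftrightarrow>
     finite \<Phi> \<and> 0 \<notin> \<Phi> \<and>
     (\<forall>\<alpha>\<in>\<Phi>. \<forall>\<beta>\<in>\<Phi>. \<beta> - (2 * (\<beta> \<bullet> \<alpha>) / (\<alpha> \<bullet> \<alpha>)) *\<^sub>R \<alpha> \<in> \<Phi>) \<and>
     (\<forall>\<alpha>\<in>\<Phi>. \<forall>\<beta>\<in>\<Phi>. 2 * (\<beta> \<bullet> \<alpha>) / (\<alpha> \<bullet> \<alpha>) \<in> \<int>) \<and>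
     (\<forall>\<alpha>\<in>\<Phi>. \<forall>c::real. c *\<^sub>R \<alpha> \<in> \<Phi> \<longrightarrow> c = 1 \<or> c = -1)"

definition irreducible_root_system :: "'v::euclidean_space set \<Rightarrow> bool" where
  "irreducible_root_system \<Phi> \<longleftrightarrow> \<Phi> \<noteq> {} \<and>
     \<not> (\<exists>A B. A \<noteq> {} \<and> B \<noteq> {} \<and> A \<union> B = \<Phi> \<and> A \<inter> B = {} \<and>
             (\<forall>\<alpha>\<in>A. \<forall>\<beta>\<in>B. \<alpha> \<bullet> \<beta> = 0))"

definition is_base :: "'v::euclidean_space set \<Rightarrow> 'v set \<Rightarrow> bool" where
  "is_base \<Phi> S \<longleftrightarrow> S \<subseteq> \<Phi> \<and> independent S \<and>
     (\<forall>\<alpha>\<in>\<Phi>. \<exists>c::'v \<Rightarrow> int. \<alpha> = (\<Sum>\<pi>\<in>S. of_int (c \<pi>) *\<^sub>R \<pi>) \<and>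
                 ((\<forall>\<pi>\<in>S. c \<pi> \<ge> 0) \<or> (\<forall>\<pi>\<in>S. c \<pi> \<le> 0)))"

definition finite_positive_roots :: "'v::euclidean_space set \<Rightarrow> bool" where
  "finite_positive_roots P \<longleftrightarrow>
     (\<exists>\<Phi> S. finite_root_system \<Phi> \<and> is_base \<Phi> S \<and> P = \<Phi> \<inter> pos_span S)"

text \<open>P is the set of positive roots of the untwisted affinization
  {\<alpha> + k\<delta> : \<alpha> \<in> \<Phi>0, k \<in> \<int>} of a finite irreducible crystallographic root system \<Phi>0
  (imaginary roots excluded), with base S0 \<union> {\<delta> - \<theta>}, \<theta> the highest root.\<close>
definition affine_positive_roots :: "'v::euclidean_space set \<Rightarrow> bool" where
  "affine_positive_roots P \<longleftrightarrow>
     (\<exists>\<Phi>0 S0 \<theta> \<delta>. finite_root_system \<Phi>0 \<and> irreducible_root_system \<Phi>0 \<and> is_base \<Phi>0 S0 \<and>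
        \<theta> \<in> \<Phi>0 \<and> (\<forall>\<beta>\<in>\<Phi>0. \<theta> - \<beta> \<in> pos_span S0) \<and>
        \<delta> \<notin> span \<Phi>0 \<and>
        P = {\<alpha> + of_int k *\<^sub>R \<delta> | \<alpha> k. \<alpha> \<in> \<Phi>0} \<inter> pos_span (S0 \<union> {\<delta> - \<theta>}))"

definition biclosed :: "'v::real_vector set \<Rightarrow> 'v set \<Rightarrow> bool" where
  "biclosed P B \<longleftrightarrow> B \<subseteq> P \<and>
     (\<forall>\<alpha>\<in>P. \<forall>\<beta>\<in>P. \<forall>\<gamma>\<in>P. \<gamma> \<in> pos_span {\<alpha>, \<beta>} \<longrightarrow>
        (\<alpha> \<in> B \<and> \<beta> \<in> B \<longrightarrow> \<gamma> \<in> B) \<and> (\<alpha> \<notin> B \<and> \<beta> \<notin> B \<longrightarrow> \<gamma> \<notin> B))"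

definition max_chain_ext_weak :: "'v::real_vector set \<Rightarrow> 'v set set \<Rightarrow> bool" where
  "max_chain_ext_weak P C \<longleftrightarrow> subset.maxchain {B. biclosed P B} C"

definition initial_segments :: "'v set \<Rightarrow> 'v rel \<Rightarrow> 'v set set" where
  "initial_segments P R = {I. I \<subseteq> P \<and> (\<forall>x\<in>I. \<forall>y. (y, x) \<in> R \<longrightarrow> y \<in> I)}"

end

theory Submission
  imports Defs
begin

text \<open>
  A maximal chain is given by a total order as soon as two distinct positive roots can always be
  separated in it, that is, as soon as no biclosed set covers another one with two or more roots
  in between. So the point is: if \<open>B1 \<subset> B2\<close> are biclosed, then some root of \<open>B2 - B1\<close> can be
  added to \<open>B1\<close> or removed from \<open>B2\<close>.

  If \<open>B1\<close> is finite, reflecting in the simple roots that it contains reduces to \<open>B1 = {}\<close>,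
  where any simple root in \<open>B2\<close> can be added. In affine type, let \<open>N\<^sub>i\<close> be the set of \<open>\<alpha>\<close> in the
  finite root system such that \<open>\<alpha> + k\<delta>\<close> is in \<open>B\<^sub>i\<close> for all large \<open>k\<close>; both \<open>N\<^sub>i\<close> and its complement
  are closed. The roots \<open>\<alpha>\<close> with neither \<open>\<alpha>\<close> nor \<open>-\<alpha>\<close> in \<open>N\<^sub>1\<close> span an affine subsystem in which
  \<open>B1\<close> is finite, and a root that can be added within this subsystem can be added to \<open>B1\<close>. Passing
  to complements, the same holds for the roots with both \<open>\<alpha>\<close> and \<open>-\<alpha>\<close> in \<open>N\<^sub>2\<close>. If \<open>B2 - B1\<close> meets
  neither subsystem, it is empty, since \<open>\<alpha> \<in> N\<close> and \<open>-\<alpha> \<notin> N\<close> force all positive \<open>\<alpha> + k\<delta>\<close> into \<open>B\<close>.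
\<close>

section \<open>Cones spanned by two vectors\<close>

lemma pos_span_pair:
  "x \<in> pos_span {u, v} \<longleftrightarrow> (\<exists>a b. 0 \<le> a \<and> 0 \<le> b \<and> x = a *\<^sub>R u + b *\<^sub>R v)"
proof
  assume "x \<in> pos_span {u, v}"
  then obtain T c where T: "T \<subseteq> {u, v}" "\<forall>w\<in>T. c w \<ge> 0" "x = (\<Sum>w\<in>T. c w *\<^sub>R w)"
    unfolding pos_span_def by auto
  define d where "d w = (if w \<in> T then c w else 0)" for w
  have "x = (\<Sum>w\<in>{u, v}. d w *\<^sub>R w)"
    unfolding T(3) d_def using T(1) by (intro sum.mono_neutral_cong_left) auto
  moreover have "d w \<ge> 0" for w using T(2) by (auto simp: d_def)
  ultimately show "\<exists>a b. 0 \<le> a \<and> 0 \<le> b \<and> x = a *\<^sub>R u + b *\<^sub>R v"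
    by (cases "u = v") (force intro: exI[of _ "d u"] exI[of _ "0::real"], auto)
next
  assume "\<exists>a b. 0 \<le> a \<and> 0 \<le> b \<and> x = a *\<^sub>R u + b *\<^sub>R v"
  then obtain a b where ab: "0 \<le> a" "0 \<le> b" "x = a *\<^sub>R u + b *\<^sub>R v" by auto
  show "x \<in> pos_span {u, v}"
  proof (cases "u = v")
    case True
    then show ?thesis unfolding pos_span_def using ab
      by (auto simp: scaleR_left_distrib intro!: exI[of _ "{v}"] exI[of _ "\<lambda>_. a + b"])
  next
    case False
    then show ?thesis unfolding pos_span_def using ab
      by (auto intro!: exI[of _ "{u, v}"] exI[of _ "\<lambda>w. if w = u then a else b"])
  qed
qed

lemma pos_spanI: "x = a *\<^sub>R u + b *\<^sub>R v \<Longrightarrow> 0 \<le> a \<Longrightarrow> 0 \<le> b \<Longrightarrow> x \<in> pos_span {u, v}"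
  unfolding pos_span_pair by blast

text \<open>Relations between roots are mostly found by moving terms across an equation, which
  leaves a positive multiple of \<open>x\<close> on the left.\<close>

lemma pos_spanI2: "c *\<^sub>R x = a *\<^sub>R u + b *\<^sub>R v \<Longrightarrow> 0 \<le> a \<Longrightarrow> 0 \<le> b \<Longrightarrow> 0 < c \<Longrightarrow> x \<in> pos_span {u, v}"
proof (rule pos_spanI[of _ "a / c" _ "b / c"])
  assume "c *\<^sub>R x = a *\<^sub>R u + b *\<^sub>R v" "0 < c"
  then have "inverse c *\<^sub>R c *\<^sub>R x = inverse c *\<^sub>R (a *\<^sub>R u + b *\<^sub>R v)" by simp
  then show "x = (a / c) *\<^sub>R u + (b / c) *\<^sub>R v"
    using \<open>0 < c\<close> by (simp add: scaleR_add_right divide_inverse_commute)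
qed auto

lemma pos_span_swap: "pos_span {u, v} = pos_span {v, u}"
  by (simp add: insert_commute)

section \<open>Maximal chains and total orders\<close>

lemma biclosedI:
  assumes "B \<subseteq> P"
    and "\<And>\<alpha> \<beta> \<gamma>. \<alpha> \<in> B \<Longrightarrow> \<beta> \<in> B \<Longrightarrow> \<gamma> \<in> P \<Longrightarrow> \<gamma> \<in> pos_span {\<alpha>, \<beta>} \<Longrightarrow> \<gamma> \<in> B"
    and "\<And>\<alpha> \<beta> \<gamma>. \<alpha> \<in> P - B \<Longrightarrow> \<beta> \<in> P - B \<Longrightarrow> \<gamma> \<in> B \<Longrightarrow> \<gamma> \<in> pos_span {\<alpha>, \<beta>} \<Longrightarrow> False"
  shows "biclosed P B"
  unfolding biclosed_def using assms by blast

lemma biclosed_closed: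
  "biclosed P B \<Longrightarrow> \<alpha> \<in> B \<Longrightarrow> \<beta> \<in> B \<Longrightarrow> \<gamma> \<in> P \<Longrightarrow> \<gamma> \<in> pos_span {\<alpha>, \<beta>} \<Longrightarrow> \<gamma> \<in> B"
  unfolding biclosed_def by blast

lemma biclosed_coclosed:
  "biclosed P B \<Longrightarrow> \<alpha> \<in> P \<Longrightarrow> \<alpha> \<notin> B \<Longrightarrow> \<beta> \<in> P \<Longrightarrow> \<beta> \<notin> B \<Longrightarrow> \<gamma> \<in> pos_span {\<alpha>, \<beta>} \<Longrightarrow> \<gamma> \<notin> B"
  unfolding biclosed_def by blast

lemma biclosed_subset: "biclosed P B \<Longrightarrow> B \<subseteq> P"
  unfolding biclosed_def by blast

lemma biclosed_complement: "biclosed P B \<Longrightarrow> biclosed P (P - B)"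
  unfolding biclosed_def by blast

lemma biclosed_restrict: "biclosed P B \<Longrightarrow> Q \<subseteq> P \<Longrightarrow> biclosed Q (B \<inter> Q)"
  unfolding biclosed_def by blast

lemma biclosed_self: "biclosed P P"
  unfolding biclosed_def by blast

text \<open>The order is read off the chain: \<open>x\<close> precedes \<open>y\<close> when each
  member of \<open>C\<close> containing \<open>y\<close> contains \<open>x\<close>. Totality comes
  from comparability of the members; antisymmetry is where \<open>dense\<close> enters. Conversely,
  an order that yields \<open>C\<close> has its principal segments in \<open>C\<close>, and these
  determine it.\<close>

lemma maxchain_total_order:
  fixes P :: "'v::real_vector set"
  assumes mc: "max_chain_ext_weak P C"
    and dense: "\<And>B1 B2 x y. \<lbrakk>biclosed P B1; biclosed P B2; B1 \<subseteq> B2; x \<in> B2 - B1; y \<in> B2 - B1; x \<noteq> y\<rbrakk>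
      \<Longrightarrow> \<exists>B. biclosed P B \<and> B1 \<subset> B \<and> B \<subset> B2"
  shows "\<exists>!R. R \<subseteq> P \<times> P \<and> linear_order_on P R \<and> C = initial_segments P R"
proof -
  have bic: "biclosed P B" if "B \<in> C" for B
    using mc that unfolding max_chain_ext_weak_def subset.maxchain_def subset.chain_def by blast
  have comp: "A \<subseteq> B \<or> B \<subseteq> A" if "A \<in> C" "B \<in> C" for A B
    using mc that unfolding max_chain_ext_weak_def subset.maxchain_def subset.chain_def by blast
  have maxi: "B \<in> C" if B: "biclosed P B" "\<And>A. A \<in> C \<Longrightarrow> A \<subseteq> B \<or> B \<subseteq> A" for B
  proof (rule ccontr)
    assume "B \<notin> C"
    have "subset.chain {B. biclosed P B} (insert B C)"
      using bic comp B unfolding subset_chain_def by blast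
    then show False
      using mc \<open>B \<notin> C\<close> unfolding max_chain_ext_weak_def subset.maxchain_def by blast
  qed
  have PC: "P \<in> C" by (rule maxi) (use bic biclosed_subset biclosed_self in blast)+
  define R where "R = {(x, y). x \<in> P \<and> y \<in> P \<and> (\<forall>B\<in>C. y \<in> B \<longrightarrow> x \<in> B)}"
  \<comment> \<open>If no member separates \<open>x\<close> from \<open>y\<close>, the members
    missing both and those containing both leave a gap between \<open>B1\<close> and
    \<open>B2\<close>, which are biclosed as the union and the intersection of a chain. A biclosed
    set strictly in the gap is comparable with every member, so it lies in \<open>C\<close> by
    maximality, which the gap forbids.\<close>
  have sep: "x = y" if xy: "x \<in> P" "\<And>B. B \<in> C \<Longrightarrow> x \<in> B \<longleftrightarrow> y \<in> B" for x y
  proof (rule ccontr)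
    assume "x \<noteq> y"
    define B1 where "B1 = \<Union>{B \<in> C. x \<notin> B}"
    define B2 where "B2 = \<Inter>{B \<in> C. x \<in> B}"
    have B1: "biclosed P B1"
    proof (rule biclosedI)
      show "B1 \<subseteq> P" unfolding B1_def using bic biclosed_subset by blast
    next
      fix \<alpha> \<beta> \<gamma> assume a: "\<alpha> \<in> B1" "\<beta> \<in> B1" "\<gamma> \<in> P" "\<gamma> \<in> pos_span {\<alpha>, \<beta>}"
      then obtain A where "A \<in> C" "x \<notin> A" "\<alpha> \<in> A" "\<beta> \<in> A"
        unfolding B1_def using comp by blast
      then show "\<gamma> \<in> B1" using biclosed_closed[OF bic, of A \<alpha> \<beta> \<gamma>] a unfolding B1_def by blast
    next
      fix \<alpha> \<beta> \<gamma> assume a: "\<alpha> \<in> P - B1" "\<beta> \<in> P - B1" "\<gamma> \<in> B1" "\<gamma> \<in> pos_span {\<alpha>, \<beta>}"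
      then obtain A where "A \<in> C" "x \<notin> A" "\<gamma> \<in> A" unfolding B1_def by blast
      then show False using biclosed_coclosed[OF bic, of A \<alpha> \<beta> \<gamma>] a unfolding B1_def by blast
    qed
    have B2: "biclosed P B2"
    proof (rule biclosedI)
      show "B2 \<subseteq> P" unfolding B2_def using PC xy by blast
    next
      fix \<alpha> \<beta> \<gamma> assume a: "\<alpha> \<in> B2" "\<beta> \<in> B2" "\<gamma> \<in> P" "\<gamma> \<in> pos_span {\<alpha>, \<beta>}"
      then show "\<gamma> \<in> B2" using biclosed_closed[OF bic, of _ \<alpha> \<beta> \<gamma>] unfolding B2_def by blast
    next
      fix \<alpha> \<beta> \<gamma> assume a: "\<alpha> \<in> P - B2" "\<beta> \<in> P - B2" "\<gamma> \<in> B2" "\<gamma> \<in> pos_span {\<alpha>, \<beta>}"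
      then obtain A where "A \<in> C" "x \<in> A" "\<alpha> \<notin> A" "\<beta> \<notin> A" unfolding B2_def using comp by blast
      then show False using biclosed_coclosed[OF bic, of A \<alpha> \<beta> \<gamma>] a unfolding B2_def by blast
    qed
    have "B1 \<subseteq> B2" unfolding B1_def B2_def using comp by blast
    moreover have "x \<in> B2 - B1" "y \<in> B2 - B1" unfolding B1_def B2_def using xy by blast+
    ultimately obtain B where B: "biclosed P B" "B1 \<subset> B" "B \<subset> B2"
      using dense[OF B1 B2 _ _ _ \<open>x \<noteq> y\<close>] by blast
    have "B \<in> C"
      by (rule maxi[OF B(1)]) (use B in \<open>auto simp: B1_def B2_def\<close>)
    then show False using B unfolding B1_def B2_def by blast
  qed
  have RP: "R \<subseteq> P \<times> P" unfolding R_def by auto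
  have "linear_order_on P R"
    unfolding linear_order_on_def partial_order_on_def preorder_on_def
  proof (intro conjI)
    show "refl_on P R" unfolding refl_on_def R_def by auto
    show "trans R" unfolding trans_def R_def by blast
    show "antisym R" unfolding R_def by (rule antisymI) (auto intro!: sep)
    show "total_on P R"
    proof (rule total_onI)
      fix x y assume xy: "x \<in> P" "y \<in> P"
      show "(x, y) \<in> R \<or> (y, x) \<in> R"
      proof (rule ccontr)
        assume "\<not> ?thesis"
        then obtain A B where "A \<in> C" "y \<in> A" "x \<notin> A" "B \<in> C" "x \<in> B" "y \<notin> B"
          unfolding R_def using xy by auto
        then show False using comp[of A B] by blast
      qed
    qed
    show "R \<subseteq> P \<times> P" by (rule RP)
  qed
  moreover have "C = initial_segments P R"
  proof
    show "C \<subseteq> initial_segments P R"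
      unfolding initial_segments_def R_def using bic biclosed_subset by blast
    show "initial_segments P R \<subseteq> C"
    proof
      fix I assume "I \<in> initial_segments P R"
      \<comment> \<open>Initial segments are used in this separated form: if \<open>I\<close>
        violates closedness or coclosedness, the two separating members are nested, and one of them
        shows the same violation.\<close>
      then have IP: "I \<subseteq> P" and I: "\<And>x y. x \<in> I \<Longrightarrow> y \<in> P \<Longrightarrow> y \<notin> I \<Longrightarrow> \<exists>B\<in>C. x \<in> B \<and> y \<notin> B"
        unfolding initial_segments_def R_def by blast+
      show "I \<in> C"
      proof (rule maxi)
        show "biclosed P I"
        proof (rule biclosedI[OF IP])
          fix \<alpha> \<beta> \<gamma> assume a: "\<alpha> \<in> I" "\<beta> \<in> I" "\<gamma> \<in> P" "\<gamma> \<in> pos_span {\<alpha>, \<beta>}"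
          show "\<gamma> \<in> I"
          proof (rule ccontr)
            assume "\<gamma> \<notin> I"
            then obtain A B where "A \<in> C" "\<alpha> \<in> A" "\<gamma> \<notin> A" "B \<in> C" "\<beta> \<in> B" "\<gamma> \<notin> B"
              using I a by meson
            then obtain D where "D \<in> C" "\<alpha> \<in> D" "\<beta> \<in> D" "\<gamma> \<notin> D" using comp[of A B] by blast
            then show False using biclosed_closed[OF bic, of D \<alpha> \<beta> \<gamma>] a by blast
          qed
        next
          fix \<alpha> \<beta> \<gamma> assume a: "\<alpha> \<in> P - I" "\<beta> \<in> P - I" "\<gamma> \<in> I" "\<gamma> \<in> pos_span {\<alpha>, \<beta>}"
          then obtain A B where "A \<in> C" "\<gamma> \<in> A" "\<alpha> \<notin> A" "B \<in> C" "\<gamma> \<in> B" "\<beta> \<notin> B"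
            using I by (metis DiffE)
          then obtain D where "D \<in> C" "\<gamma> \<in> D" "\<alpha> \<notin> D" "\<beta> \<notin> D" using comp[of A B] by blast
          then show False using biclosed_coclosed[OF bic, of D \<alpha> \<beta> \<gamma>] a by blast
        qed
      next
        fix B assume "B \<in> C"
        show "B \<subseteq> I \<or> I \<subseteq> B"
        proof (rule disjCI)
          assume "\<not> I \<subseteq> B"
          then obtain i where i: "i \<in> I" "i \<notin> B" by blast
          show "B \<subseteq> I"
          proof
            fix x assume x: "x \<in> B"
            show "x \<in> I"
            proof (rule ccontr)
              assume "x \<notin> I"
              then obtain A where "A \<in> C" "i \<in> A" "x \<notin> A"
                using I[OF i(1), of x] x \<open>B \<in> C\<close> bic biclosed_subset by blast
              then show False using comp[OF \<open>B \<in> C\<close>, of A] i x by blast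
            qed
          qed
        qed
      qed
    qed
  qed
  moreover have "R' = R" if R': "R' \<subseteq> P \<times> P" "linear_order_on P R'" "C = initial_segments P R'" for R'
  proof -
    have tr: "trans R'" and rf: "\<And>y. y \<in> P \<Longrightarrow> (y, y) \<in> R'"
      using R'(2) unfolding linear_order_on_def partial_order_on_def preorder_on_def refl_on_def by auto
    have seg: "{z. (z, y) \<in> R'} \<in> initial_segments P R'" for y
      unfolding initial_segments_def using R'(1) transD[OF tr] by auto
    have "(x, y) \<in> R' \<longleftrightarrow> (x, y) \<in> R" for x y
    proof
      assume xy: "(x, y) \<in> R'"
      then have "x \<in> B" if "B \<in> C" "y \<in> B" for B
        using that unfolding R'(3) initial_segments_def by auto
      then show "(x, y) \<in> R" using xy R'(1) unfolding R_def by auto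
    next
      assume "(x, y) \<in> R"
      then have "y \<in> P" and xB: "\<And>B. B \<in> C \<Longrightarrow> y \<in> B \<Longrightarrow> x \<in> B" unfolding R_def by auto
      then show "(x, y) \<in> R'" using xB[of "{z. (z, y) \<in> R'}"] seg[of y] rf[of y] R'(3) by simp
    qed
    then show ?thesis by auto
  qed
  ultimately show ?thesis using RP by blast
qed

section \<open>Positive systems and simple roots\<close>

lemma ex_min_Ints:
  fixes f :: "'a \<Rightarrow> real"
  assumes "A \<noteq> {}" "\<And>x. x \<in> A \<Longrightarrow> f x \<in> \<int> \<and> f x > 0"
  shows "\<exists>x\<in>A. \<forall>y\<in>A. f x \<le> f y"
proof -
  define m where "m x = nat \<lfloor>f x\<rfloor>" for x
  have m: "f x = real (m x)" if "x \<in> A" for x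
    using assms(2)[OF that] by (auto simp: m_def elim!: Ints_cases)
  obtain x0 where "x0 \<in> A" using assms(1) by auto
  then obtain x where "x \<in> A" "\<forall>y. y \<in> A \<longrightarrow> m x \<le> m y"
    using ex_has_least_nat[of "\<lambda>x. x \<in> A" x0 m] by blast
  then show ?thesis using m by (intro bexI[of _ x]) auto
qed

text \<open>In affine type, \<open>\<pi>\<close> is the projection along \<open>\<delta>\<close>, so that the pairing
  \<open>\<pi> \<alpha> \<bullet> \<pi> \<beta>\<close> is the invariant semidefinite form, with radical spanned by \<open>\<delta>\<close>.\<close>

locale crystal =
  fixes \<Psi> :: "'v::euclidean_space set" and \<pi> :: "'v \<Rightarrow> 'v"
  assumes linear_proj: "linear \<pi>"
    and proj_nonzero: "\<alpha> \<in> \<Psi> \<Longrightarrow> \<pi> \<alpha> \<noteq> 0"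
    and reflection: "\<alpha> \<in> \<Psi> \<Longrightarrow> \<beta> \<in> \<Psi> \<Longrightarrow> \<beta> - (2 * (\<pi> \<beta> \<bullet> \<pi> \<alpha>) / (\<pi> \<alpha> \<bullet> \<pi> \<alpha>)) *\<^sub>R \<alpha> \<in> \<Psi>"
    and cartan_Ints: "\<alpha> \<in> \<Psi> \<Longrightarrow> \<beta> \<in> \<Psi> \<Longrightarrow> 2 * (\<pi> \<beta> \<bullet> \<pi> \<alpha>) / (\<pi> \<alpha> \<bullet> \<pi> \<alpha>) \<in> \<int>"
    and reduced: "\<alpha> \<in> \<Psi> \<Longrightarrow> c *\<^sub>R \<alpha> \<in> \<Psi> \<Longrightarrow> c = 1 \<or> c = -1"
begin

definition cartan :: "'v \<Rightarrow> 'v \<Rightarrow> real" where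
  "cartan \<beta> \<alpha> = 2 * (\<pi> \<beta> \<bullet> \<pi> \<alpha>) / (\<pi> \<alpha> \<bullet> \<pi> \<alpha>)"

definition refl :: "'v \<Rightarrow> 'v \<Rightarrow> 'v" where
  "refl \<alpha> \<beta> = \<beta> - cartan \<beta> \<alpha> *\<^sub>R \<alpha>"

text \<open>\<open>h\<close> is integral and vanishes at no root, so it cuts out a positive system.
  The last clause concerns affine type: roots with equal projection differ by a multiple of
  \<delta>, and \<open>h\<close> must tell them apart.\<close>

definition height :: "('v \<Rightarrow> real) \<Rightarrow> bool" where
  "height h \<longleftrightarrow> linear h \<and> (\<forall>\<alpha>\<in>\<Psi>. h \<alpha> \<in> \<int> \<and> h \<alpha> \<noteq> 0) \<and>
     (\<forall>\<alpha>\<in>\<Psi>. \<forall>\<beta>\<in>\<Psi>. \<pi> \<alpha> = \<pi> \<beta> \<longrightarrow> h \<alpha> = h \<beta> \<longrightarrow> \<alpha> = \<beta>)"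

definition pos :: "('v \<Rightarrow> real) \<Rightarrow> 'v set" where
  "pos h = {\<alpha> \<in> \<Psi>. h \<alpha> > 0}"

text \<open>Indecomposability is phrased with the two-root cones that occur in
  \<open>biclosed\<close>, so that simplicity of a positive root \<open>s\<close> amounts to
  coclosedness of \<open>{s}\<close>.\<close>

definition simple :: "('v \<Rightarrow> real) \<Rightarrow> 'v \<Rightarrow> bool" where
  "simple h s \<longleftrightarrow> s \<in> pos h \<and> (\<forall>\<alpha>\<in>pos h. \<forall>\<beta>\<in>pos h. s \<in> pos_span {\<alpha>, \<beta>} \<longrightarrow> \<alpha> = s \<or> \<beta> = s)"

lemma proj_pos: "\<alpha> \<in> \<Psi> \<Longrightarrow> \<pi> \<alpha> \<bullet> \<pi> \<alpha> > 0"
  using proj_nonzero by auto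

lemma refl_mem: "\<alpha> \<in> \<Psi> \<Longrightarrow> \<beta> \<in> \<Psi> \<Longrightarrow> refl \<alpha> \<beta> \<in> \<Psi>"
  using reflection unfolding refl_def cartan_def by auto

lemma cartan_mem_Ints: "\<alpha> \<in> \<Psi> \<Longrightarrow> \<beta> \<in> \<Psi> \<Longrightarrow> cartan \<beta> \<alpha> \<in> \<int>"
  using cartan_Ints unfolding cartan_def by auto

lemma cartan_self: "\<alpha> \<in> \<Psi> \<Longrightarrow> cartan \<alpha> \<alpha> = 2"
  using proj_pos[of \<alpha>] unfolding cartan_def by auto

lemma uminus_mem: "\<alpha> \<in> \<Psi> \<Longrightarrow> - \<alpha> \<in> \<Psi>"
  using refl_mem[of \<alpha> \<alpha>] cartan_self[of \<alpha>] by (auto simp: refl_def scaleR_2)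

lemma cartan_pos_iff: "\<alpha> \<in> \<Psi> \<Longrightarrow> cartan \<beta> \<alpha> > 0 \<longleftrightarrow> \<pi> \<beta> \<bullet> \<pi> \<alpha> > 0"
  using proj_pos[of \<alpha>] inner_ge_zero[of "\<pi> \<alpha>"] unfolding cartan_def
  by (auto simp add: zero_less_divide_iff simp del: inner_gt_zero_iff inner_ge_zero)

lemma linear_refl: "linear (refl s)"
proof -
  have "cartan (x + y) s = cartan x s + cartan y s" "cartan (c *\<^sub>R x) s = c * cartan x s" for x y c
    unfolding cartan_def using linear_proj
    by (simp_all add: linear_add linear_scale inner_add_left add_divide_distrib distrib_left)
  then show ?thesis
    by (intro linearI) (simp_all add: refl_def algebra_simps)
qed

lemma refl_refl: "s \<in> \<Psi> \<Longrightarrow> refl s (refl s x) = x"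
proof -
  assume s: "s \<in> \<Psi>"
  have "cartan (refl s x) s = - cartan x s"
    using proj_pos[OF s] linear_proj unfolding refl_def cartan_def
    by (simp add: linear_diff linear_scale inner_diff_left field_simps)
  then show ?thesis unfolding refl_def[of s "refl s x"] by (simp add: refl_def)
qed

lemma cartan_product_le_4:
  assumes "\<alpha> \<in> \<Psi>" "\<beta> \<in> \<Psi>" shows "cartan \<beta> \<alpha> * cartan \<alpha> \<beta> \<le> 4"
proof -
  have "(\<pi> \<beta> \<bullet> \<pi> \<alpha>)^2 \<le> (\<pi> \<beta> \<bullet> \<pi> \<beta>) * (\<pi> \<alpha> \<bullet> \<pi> \<alpha>)" by (rule Cauchy_Schwarz_ineq)
  then show ?thesis using proj_pos[OF assms(1)] proj_pos[OF assms(2)] unfolding cartan_def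
    by (simp add: field_simps power2_eq_square inner_commute)
qed

text \<open>The two Cartan integers are positive with product at most 4. If one of them is 1, a
  reflection yields the difference up to sign. Otherwise both are 2, the equality case of
  Cauchy-Schwarz, and the projections agree.\<close>

lemma diff_mem_or_proj_eq:
  assumes y: "y \<in> \<Psi>" and a: "\<alpha> \<in> \<Psi>" and pr: "\<pi> y \<bullet> \<pi> \<alpha> > 0"
  shows "y - \<alpha> \<in> \<Psi> \<or> \<pi> y = \<pi> \<alpha>"
proof -
  obtain m n :: int where m: "cartan y \<alpha> = m" and n: "cartan \<alpha> y = n"
    using cartan_mem_Ints[OF a y] cartan_mem_Ints[OF y a] by (auto elim!: Ints_cases)
  have mn: "m > 0" "n > 0"
    using cartan_pos_iff[OF a, of y] cartan_pos_iff[OF y, of \<alpha>] pr m n by (auto simp: inner_commute)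
  have "of_int (m * n) \<le> (4::real)" using cartan_product_le_4[OF a y] m n by simp
  then have mn4: "m * n \<le> 4" by linarith
  consider "m = 1" | "n = 1" | "m \<ge> 2" "n \<ge> 2" using mn by linarith
  then show ?thesis
  proof cases
    case 1
    then show ?thesis using refl_mem[OF a y] m by (simp add: refl_def)
  next
    case 2
    then show ?thesis using uminus_mem[OF refl_mem[OF y a]] n by (simp add: refl_def)
  next
    case 3
    have "m = 2" "n = 2"
      using 3 mn4 mult_mono[of 2 m 3 n] mult_mono[of 3 m 2 n] by (force intro: antisym)+
    then have "\<pi> y \<bullet> \<pi> \<alpha> = \<pi> \<alpha> \<bullet> \<pi> \<alpha>" "\<pi> y \<bullet> \<pi> \<alpha> = \<pi> y \<bullet> \<pi> y"
      using m n proj_pos[OF a] proj_pos[OF y] unfolding cartan_def by (auto simp: field_simps inner_commute)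
    then have "(\<pi> y - \<pi> \<alpha>) \<bullet> (\<pi> y - \<pi> \<alpha>) = 0" by (simp add: inner_diff inner_commute)
    then show ?thesis by simp
  qed
qed

lemma heightD:
  assumes "height h"
  shows "linear h" "\<alpha> \<in> \<Psi> \<Longrightarrow> h \<alpha> \<in> \<int>" "\<alpha> \<in> \<Psi> \<Longrightarrow> h \<alpha> \<noteq> 0"
    "\<alpha> \<in> \<Psi> \<Longrightarrow> \<beta> \<in> \<Psi> \<Longrightarrow> \<pi> \<alpha> = \<pi> \<beta> \<Longrightarrow> h \<alpha> = h \<beta> \<Longrightarrow> \<alpha> = \<beta>"
    "h (x + y) = h x + h y" "h (x - y) = h x - h y" "h (- x) = - h x" "h (c *\<^sub>R x) = c * h x"
  using assms unfolding height_def
  by (auto simp: linear_add linear_diff linear_neg linear_scale)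

lemma pos_or_neg: "height h \<Longrightarrow> \<alpha> \<in> \<Psi> \<Longrightarrow> \<alpha> \<in> pos h \<or> - \<alpha> \<in> pos h"
  using heightD(3,7)[of h \<alpha>] uminus_mem[of \<alpha>] unfolding pos_def by force

lemma pos_scale: "height h \<Longrightarrow> \<alpha> \<in> pos h \<Longrightarrow> c *\<^sub>R \<alpha> \<in> pos h \<Longrightarrow> c = 1"
  using reduced[of \<alpha> c] heightD(8)[of h c \<alpha>] unfolding pos_def by auto

text \<open>A vanishing coefficient would make \<gamma> a multiple of the other root, hence equal to
  it by reducedness.\<close>

lemma pos_span_coeffs:
  assumes h: "height h" and p: "\<alpha> \<in> pos h" "\<beta> \<in> pos h" "\<gamma> \<in> pos h" and n: "\<gamma> \<noteq> \<alpha>" "\<gamma> \<noteq> \<beta>"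
    and s: "\<gamma> \<in> pos_span {\<alpha>, \<beta>}"
  obtains a b where "a > 0" "b > 0" "\<gamma> = a *\<^sub>R \<alpha> + b *\<^sub>R \<beta>"
proof -
  obtain a b where ab: "a \<ge> 0" "b \<ge> 0" "\<gamma> = a *\<^sub>R \<alpha> + b *\<^sub>R \<beta>" using s unfolding pos_span_pair by auto
  have "a \<noteq> 0" using ab pos_scale[OF h p(2), of b] p(3) n by auto
  moreover have "b \<noteq> 0" using ab pos_scale[OF h p(1), of a] p(3) n by auto
  ultimately show ?thesis using ab that[of a b] by auto
qed

text \<open>A root \<open>y\<close> of least height in \<open>Y\<close> is simple: take a decomposition into a pair
  \<open>\<alpha>, \<beta>\<close> of least total height, with \<open>\<alpha>\<close> not orthogonal to \<open>y\<close>. If \<open>y - \<alpha>\<close> is a root, either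
  it contradicts the choice of \<open>y\<close> or its negative can replace \<open>\<alpha>\<close>. It can only fail to be a
  root if \<open>\<alpha>\<close> and \<open>y\<close> differ by a multiple of \<open>\<delta>\<close>.\<close>

lemma ex_simple:
  assumes h: "height h" and Y: "Y \<subseteq> pos h" "Y \<noteq> {}"
    and co: "\<And>\<alpha> \<beta> \<gamma>. \<alpha> \<in> pos h \<Longrightarrow> \<beta> \<in> pos h \<Longrightarrow> \<gamma> \<in> Y \<Longrightarrow> \<gamma> \<in> pos_span {\<alpha>, \<beta>} \<Longrightarrow> \<alpha> \<in> Y \<or> \<beta> \<in> Y"
  shows "\<exists>s\<in>Y. simple h s"
proof -
  note hl = heightD(5-8)[OF h]
  have int: "h x \<in> \<int> \<and> h x > 0" if "x \<in> pos h" for x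
    using that heightD(2)[OF h] unfolding pos_def by auto
  obtain y where y: "y \<in> Y" and ymin: "\<And>x. x \<in> Y \<Longrightarrow> h y \<le> h x"
    using ex_min_Ints[OF Y(2), of h] int Y(1) by blast
  have yp: "y \<in> pos h" "y \<in> \<Psi>" using y Y(1) unfolding pos_def by auto
  have "simple h y"
  proof (rule ccontr)
    assume ns: "\<not> simple h y"
    define D where "D = {(\<alpha>, \<beta>). \<alpha> \<in> pos h \<and> \<beta> \<in> pos h \<and> \<alpha> \<noteq> y \<and> \<beta> \<noteq> y \<and> y \<in> pos_span {\<alpha>, \<beta>}}"
    have "D \<noteq> {}" using ns yp(1) unfolding simple_def D_def by blast
    then have "\<exists>p\<in>D. \<forall>q\<in>D. h (fst p) + h (snd p) \<le> h (fst q) + h (snd q)"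
    proof (rule ex_min_Ints)
      fix x assume "x \<in> D"
      then show "h (fst x) + h (snd x) \<in> \<int> \<and> 0 < h (fst x) + h (snd x)"
        using int[of "fst x"] int[of "snd x"] by (auto simp: D_def)
    qed
    then obtain p q where D: "(p, q) \<in> D" and Dmin: "\<And>\<alpha> \<beta>. (\<alpha>, \<beta>) \<in> D \<Longrightarrow> h p + h q \<le> h \<alpha> + h \<beta>"
      by fastforce
    \<comment> \<open>Coclosedness would put one of the two lower roots into \<open>Y\<close>,
      against the choice of \<open>y\<close>.\<close>
    have low: False if "\<alpha> \<in> pos h" "\<beta> \<in> pos h" "h \<alpha> < h y" "h \<beta> < h y" "y \<in> pos_span {\<alpha>, \<beta>}" for \<alpha> \<beta>
      using co[OF that(1,2) y that(5)] ymin that(3,4) by force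
    \<comment> \<open>Minimality is asked of \<alpha> for fixed \<beta>, so that \<open>key\<close>
      can be applied to either component of a pair of least total height.\<close>
    have key: "\<pi> \<alpha> = \<pi> y \<and> h \<alpha> \<ge> h y"
      if d: "(\<alpha>, \<beta>) \<in> D" and dmin: "\<And>\<gamma>. (\<gamma>, \<beta>) \<in> D \<Longrightarrow> h \<alpha> \<le> h \<gamma>" and pr: "\<pi> y \<bullet> \<pi> \<alpha> > 0" for \<alpha> \<beta>
    proof -
      have p: "\<alpha> \<in> pos h" "\<beta> \<in> pos h" "\<alpha> \<noteq> y" "\<beta> \<noteq> y" "y \<in> pos_span {\<alpha>, \<beta>}"
        using d unfolding D_def by auto
      then have psi: "\<alpha> \<in> \<Psi>" "\<beta> \<in> \<Psi>" and hp: "h \<alpha> > 0" "h \<beta> > 0" unfolding pos_def by auto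
      obtain a b where ab: "a > 0" "b > 0" "y = a *\<^sub>R \<alpha> + b *\<^sub>R \<beta>"
        using pos_span_coeffs[OF h p(1,2) yp(1)] p by metis
      have hy: "h y = a * h \<alpha> + b * h \<beta>" by (subst ab(3)) (simp add: hl)
      have nd: "y - \<alpha> \<notin> \<Psi>"
      proof
        assume m: "y - \<alpha> \<in> \<Psi>"
        consider "y - \<alpha> \<in> pos h" | "\<alpha> - y \<in> pos h" using pos_or_neg[OF h m] by auto
        then show False
        proof cases
          case 1
          show False
            by (rule low[OF 1 p(1)])
              (use 1 hp in \<open>auto simp: pos_def hl intro: pos_spanI[of _ 1 _ 1]\<close>)
        next
          case 2
          have "h y < h \<alpha>" using 2 by (simp add: pos_def hl)
          then have "h y > a * h y" using hy mult_pos_pos[OF ab(2) hp(2)]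
              mult_strict_left_mono[OF _ ab(1), of "h y" "h \<alpha>"] by linarith
          then have a1: "a < 1" using yp by (auto simp: pos_def)
          \<comment> \<open>Subtracting \<open>a\<close> times \<open>y\<close> from both sides
            trades \<alpha> for the lower root \<alpha> - y.\<close>
          have "(1 - a) *\<^sub>R y = a *\<^sub>R (\<alpha> - y) + b *\<^sub>R \<beta>"
            using ab(3) by (simp add: algebra_simps)
          then have sp: "y \<in> pos_span {\<alpha> - y, \<beta>}" by (rule pos_spanI2) (use a1 ab in auto)
          have "\<alpha> - y \<noteq> y"
          proof
            assume "\<alpha> - y = y"
            then have "\<alpha> = 2 *\<^sub>R y" by (simp add: scaleR_2 diff_eq_eq)
            then show False using pos_scale[OF h yp(1), of 2] p by auto
          qed
          then have "(\<alpha> - y, \<beta>) \<in> D" using 2 p sp unfolding D_def by auto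
          then show False using dmin yp by (fastforce simp: pos_def hl)
        qed
      qed
      then have eq: "\<pi> \<alpha> = \<pi> y" using diff_mem_or_proj_eq[OF yp(2) psi(1) pr] by auto
      \<comment> \<open>Since the projections agree, reflecting \<open>y\<close> in \<alpha> gives
        the root y - 2\<alpha>. If it is positive, both it and \<alpha> are lower than
        \<open>y\<close>; if it is negative, 2\<alpha> - y is lower than \<alpha> and can replace
        it.\<close>
      have "h \<alpha> \<ge> h y"
      proof (rule ccontr)
        assume lt: "\<not> h \<alpha> \<ge> h y"
        have "cartan y \<alpha> = 2" using cartan_self[OF psi(1)] eq unfolding cartan_def by simp
        then have r: "refl \<alpha> y = y - 2 *\<^sub>R \<alpha>" unfolding refl_def by simp
        have m: "y - 2 *\<^sub>R \<alpha> \<in> \<Psi>" using refl_mem[OF psi(1) yp(2)] r by simp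
        consider "y - 2 *\<^sub>R \<alpha> \<in> pos h" | "2 *\<^sub>R \<alpha> - y \<in> pos h" using pos_or_neg[OF h m] by auto
        then show False
        proof cases
          case 1
          show False
            by (rule low[OF 1 p(1)])
              (use 1 lt hp in \<open>auto simp: pos_def hl intro: pos_spanI[of _ 1 _ 2]\<close>)
        next
          case 2
          have "h y * a < 2 * h y"
          proof -
            have "h y * a < 2 * (a * h \<alpha>)" using 2 ab(1) by (auto simp: pos_def hl)
            also have "\<dots> < 2 * h y" using hy mult_pos_pos[OF ab(2) hp(2)] by simp
            finally show ?thesis .
          qed
          then have a2: "a < 2" using yp by (auto simp: pos_def mult.commute)
          have "(2 - a) *\<^sub>R y = a *\<^sub>R (2 *\<^sub>R \<alpha> - y) + (2 * b) *\<^sub>R \<beta>"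
          proof -
            have "2 *\<^sub>R y = 2 *\<^sub>R (a *\<^sub>R \<alpha> + b *\<^sub>R \<beta>)" using ab(3) by simp
            then show ?thesis by (simp add: algebra_simps)
          qed
          then have sp: "y \<in> pos_span {2 *\<^sub>R \<alpha> - y, \<beta>}" by (rule pos_spanI2) (use a2 ab in auto)
          have "2 *\<^sub>R \<alpha> - y \<noteq> y"
          proof
            assume "2 *\<^sub>R \<alpha> - y = y"
            then have "2 *\<^sub>R \<alpha> = 2 *\<^sub>R y" by (simp add: scaleR_2 diff_eq_eq)
            then show False using p by simp
          qed
          then have "(2 *\<^sub>R \<alpha> - y, \<beta>) \<in> D" using 2 p sp unfolding D_def by auto
          then show False using dmin lt by (fastforce simp: hl)
        qed
      qed
      then show ?thesis using eq by auto
    qed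
    have Dswap: "(\<beta>, \<alpha>) \<in> D" if "(\<alpha>, \<beta>) \<in> D" for \<alpha> \<beta>
      using that pos_span_swap unfolding D_def by blast
    \<comment> \<open>By \<open>key\<close>, a < 1, so \<beta> pairs positively with
      \<open>y\<close> too and \<open>key\<close> applies to it. Then a + b = 1, and as neither
      height is below \<open>h y\<close>, the height of \<alpha> equals \<open>h y\<close>. The last
      clause of \<open>height\<close> turns this into \<alpha> = y.\<close>
    have fin: False
      if d: "(\<alpha>, \<beta>) \<in> D" and pr: "\<pi> y \<bullet> \<pi> \<alpha> > 0" and e: "h p + h q = h \<alpha> + h \<beta>" for \<alpha> \<beta>
    proof -
      have k1: "\<pi> \<alpha> = \<pi> y" "h \<alpha> \<ge> h y"
        using key[OF d _ pr] Dmin e by (smt (verit))+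
      have p: "\<alpha> \<in> pos h" "\<beta> \<in> pos h" "\<alpha> \<noteq> y" "\<beta> \<noteq> y" "y \<in> pos_span {\<alpha>, \<beta>}"
        using d unfolding D_def by auto
      then have psi: "\<alpha> \<in> \<Psi>" "\<beta> \<in> \<Psi>" and hp: "h \<alpha> > 0" "h \<beta> > 0" unfolding pos_def by auto
      obtain a b where ab: "a > 0" "b > 0" "y = a *\<^sub>R \<alpha> + b *\<^sub>R \<beta>"
        using pos_span_coeffs[OF h p(1,2) yp(1)] p by metis
      have hy: "h y = a * h \<alpha> + b * h \<beta>" by (subst ab(3)) (simp add: hl)
      have py: "\<pi> y = a *\<^sub>R \<pi> y + b *\<^sub>R \<pi> \<beta>"
        using k1(1) by (subst (1) ab(3)) (simp add: linear_add[OF linear_proj] linear_scale[OF linear_proj])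
      have hy0: "h y > 0" using yp by (simp add: pos_def)
      have "a * h y < h y"
        using hy mult_left_mono[OF k1(2), of a] ab(1) mult_pos_pos[OF ab(2) hp(2)] by linarith
      then have a1: "a < 1" using hy0 by simp
      have "\<pi> y \<bullet> \<pi> y = a * (\<pi> y \<bullet> \<pi> y) + b * (\<pi> y \<bullet> \<pi> \<beta>)"
        by (subst (2) py) (simp only: inner_add_right inner_scaleR_right)
      moreover have "a * (\<pi> y \<bullet> \<pi> y) < \<pi> y \<bullet> \<pi> y" using a1 proj_pos[OF yp(2)] by simp
      ultimately have "b * (\<pi> y \<bullet> \<pi> \<beta>) > 0" by linarith
      then have "\<pi> y \<bullet> \<pi> \<beta> > 0" using ab(2) by (simp add: zero_less_mult_iff)
      then have k2: "\<pi> \<beta> = \<pi> y" "h \<beta> \<ge> h y"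
        using key[OF Dswap[OF d]] Dmin[OF Dswap] e by (smt (verit))+
      have "(a + b) *\<^sub>R \<pi> y = 1 *\<^sub>R \<pi> y" using py k2(1) by (simp add: scaleR_left_distrib)
      then have "a + b = 1" using proj_nonzero[OF yp(2)] by (simp only: scaleR_right_imp_eq)
      then have "a * h y + b * h y = h y" by (metis distrib_right mult_1)
      then have "a * (h \<alpha> - h y) + b * (h \<beta> - h y) = 0" using hy by (simp add: right_diff_distrib)
      moreover have "b * (h \<beta> - h y) \<ge> 0" "a * (h \<alpha> - h y) \<ge> 0" using ab k1 k2 by simp_all
      ultimately have "a * (h \<alpha> - h y) = 0" by linarith
      then have "h \<alpha> = h y" using ab by simp
      then show False using heightD(4)[OF h psi(1) yp(2) k1(1)] p by auto
    qed
    have p: "p \<in> pos h" "q \<in> pos h" "p \<noteq> y" "q \<noteq> y" "y \<in> pos_span {p, q}"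
      using D unfolding D_def by auto
    obtain a b where ab: "a > 0" "b > 0" "y = a *\<^sub>R p + b *\<^sub>R q"
      using pos_span_coeffs[OF h p(1,2) yp(1)] p by metis
    have "\<pi> y \<bullet> \<pi> y = a * (\<pi> y \<bullet> \<pi> p) + b * (\<pi> y \<bullet> \<pi> q)"
      by (subst (2) ab(3)) (simp add: linear_add[OF linear_proj] linear_scale[OF linear_proj] inner_add_right)
    then have "\<pi> y \<bullet> \<pi> p > 0 \<or> \<pi> y \<bullet> \<pi> q > 0"
      using proj_pos[OF yp(2)] ab by (smt (verit) mult_nonneg_nonpos)
    then show False using fin[OF D] fin[OF Dswap[OF D]] by auto
  qed
  then show ?thesis using y by auto
qed

section \<open>Simple reflections and biclosed sets\<close>

lemma
  assumes h: "height h" and s: "simple h s"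
  shows height_refl: "height (h \<circ> refl s)"
    and pos_refl: "pos (h \<circ> refl s) = insert (- s) (pos h - {s})"
proof -
  note hl = heightD(5-8)[OF h]
  have sp: "s \<in> pos h" "s \<in> \<Psi>" using s unfolding simple_def pos_def by auto
  have ss: "refl s s = - s" using cartan_self[OF sp(2)] by (simp add: refl_def scaleR_2)
  have "linear (h \<circ> refl s)" using linear_compose[OF linear_refl heightD(1)[OF h]] .
  moreover have "\<alpha> = \<beta>"
    if ab: "\<alpha> \<in> \<Psi>" "\<beta> \<in> \<Psi>" "\<pi> \<alpha> = \<pi> \<beta>" "h (refl s \<alpha>) = h (refl s \<beta>)" for \<alpha> \<beta>
  proof -
    have "cartan \<alpha> s = cartan \<beta> s" using ab(3) by (simp add: cartan_def)
    then show ?thesis using ab(4) heightD(4)[OF h ab(1-3)] by (simp add: refl_def hl)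
  qed
  ultimately show "height (h \<circ> refl s)"
    using heightD(2,3)[OF h] refl_mem[OF sp(2)] unfolding height_def by auto
  \<comment> \<open>If \<alpha> went to a negative root, \<open>s\<close> would lie in the cone of
    the positive roots \<alpha> and c s - \<alpha>. Indecomposability then makes \<alpha> a multiple
    of \<open>s\<close>.\<close>
  have stay: "refl s \<alpha> \<in> pos h" if a: "\<alpha> \<in> pos h" "\<alpha> \<noteq> s" for \<alpha>
  proof (rule ccontr)
    assume n: "refl s \<alpha> \<notin> pos h"
    have aP: "\<alpha> \<in> \<Psi>" using a unfolding pos_def by auto
    define c where "c = cartan \<alpha> s"
    have b: "c *\<^sub>R s - \<alpha> \<in> pos h"
      using pos_or_neg[OF h refl_mem[OF sp(2) aP]] n by (simp add: refl_def c_def)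
    then have "c * h s > 0" using a by (simp add: pos_def hl)
    then have c: "c > 0" using sp by (simp add: pos_def zero_less_mult_iff)
    have "s \<in> pos_span {\<alpha>, c *\<^sub>R s - \<alpha>}"
      using c by (intro pos_spanI2[of c _ 1 _ 1]) auto
    then have "c *\<^sub>R s - \<alpha> = s" using s a b unfolding simple_def by blast
    then have "\<alpha> = (c - 1) *\<^sub>R s" by (simp add: algebra_simps)
    then show False using pos_scale[OF h sp(1), of "c - 1"] a by auto
  qed
  show "pos (h \<circ> refl s) = insert (- s) (pos h - {s})" (is "?L = ?R")
  proof
    show "?R \<subseteq> ?L"
      using stay ss sp uminus_mem[OF sp(2)] linear_neg[OF linear_refl, of s s]
      by (auto simp: pos_def)
    show "?L \<subseteq> ?R"
    proof
      fix \<alpha> assume "\<alpha> \<in> ?L"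
      then have a: "\<alpha> \<in> \<Psi>" "refl s \<alpha> \<in> pos h" using refl_mem[OF sp(2)] by (auto simp: pos_def)
      show "\<alpha> \<in> ?R"
      proof (cases "refl s \<alpha> = s")
        case True
        then have "\<alpha> = - s" using refl_refl[OF sp(2), of \<alpha>] ss by simp
        then show ?thesis by simp
      next
        case False
        then have "\<alpha> \<in> pos h" using stay[OF a(2)] refl_refl[OF sp(2)] by simp
        moreover have "\<alpha> \<noteq> s" using a ss sp by (auto simp: pos_def hl)
        ultimately show ?thesis by simp
      qed
    qed
  qed
qed

text \<open>Moving the term in \<open>s\<close> across a relation gives one in \<open>- s\<close>
  with the other two roots exchanged. As \<open>s\<close> lies in \<open>B\<close> and
  \<open>- s\<close> lies outside \<open>B - {s}\<close>, closedness conditions involving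
  \<open>s\<close> become coclosedness conditions involving \<open>- s\<close>.\<close>

lemma biclosed_flip:
  assumes h: "height h" and s: "simple h s" and B: "s \<in> B" "B \<subseteq> pos h"
  shows "biclosed (pos h) B \<longleftrightarrow> biclosed (insert (- s) (pos h - {s})) (B - {s})"
proof
  note hl = heightD(5-8)[OF h]
  have sp: "s \<in> pos h" using s unfolding simple_def by auto
  have ms: "- s \<notin> pos h" using sp by (auto simp: pos_def hl)
  then have ms': "- s \<noteq> s" using sp by metis
  have dec: "\<alpha> = s \<or> \<beta> = s" if "\<alpha> \<in> pos h" "\<beta> \<in> pos h" "s \<in> pos_span {\<alpha>, \<beta>}" for \<alpha> \<beta>
    using s that unfolding simple_def by blast
  have neg: "- s \<notin> pos_span {\<alpha>, \<beta>}" if "\<alpha> \<in> pos h" "\<beta> \<in> pos h" for \<alpha> \<beta>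
  proof
    assume "- s \<in> pos_span {\<alpha>, \<beta>}"
    then obtain a b where ab: "a \<ge> 0" "b \<ge> 0" "- s = a *\<^sub>R \<alpha> + b *\<^sub>R \<beta>" unfolding pos_span_pair by auto
    have "- h s = a * h \<alpha> + b * h \<beta>" using arg_cong[OF ab(3), of h] by (simp add: hl)
    moreover have "a * h \<alpha> \<ge> 0" "b * h \<beta> \<ge> 0" using ab that by (auto simp: pos_def)
    ultimately show False using sp by (simp add: pos_def)
  qed
  have turn: "\<beta> \<in> pos_span {\<gamma>, s}"
    if g: "\<gamma> \<in> pos h" "\<beta> \<in> pos h" "\<gamma> \<in> pos_span {- s, \<beta>}" for \<gamma> \<beta>
  proof -
    obtain a b where ab: "a \<ge> 0" "b \<ge> 0" "\<gamma> = a *\<^sub>R (- s) + b *\<^sub>R \<beta>" using g unfolding pos_span_pair by auto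
    have "h \<gamma> = b * h \<beta> - a * h s" by (subst ab(3)) (simp add: hl)
    moreover have "a * h s \<ge> 0" using ab sp by (auto simp: pos_def)
    ultimately have "b \<noteq> 0" using g by (auto simp: pos_def)
    then show ?thesis using ab by (intro pos_spanI2[of b _ 1 _ a]) auto
  qed
  have turn': "\<beta> \<in> pos_span {\<gamma>, - s}"
    if g: "\<gamma> \<in> pos h" "\<gamma> \<noteq> s" "\<gamma> \<in> pos_span {s, \<beta>}" for \<gamma> \<beta>
  proof -
    obtain a b where ab: "a \<ge> 0" "b \<ge> 0" "\<gamma> = a *\<^sub>R s + b *\<^sub>R \<beta>" using g unfolding pos_span_pair by auto
    have "b \<noteq> 0" using ab pos_scale[OF h sp, of a] g by auto
    then show ?thesis using ab by (intro pos_spanI2[of b _ 1 _ a]) auto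
  qed
  {
    assume bc: "biclosed (pos h) B"
    have main: "\<gamma> \<notin> B" if "\<beta> \<in> pos h" "\<beta> \<notin> B" "\<gamma> \<in> pos h" "\<gamma> \<in> pos_span {- s, \<beta>}" for \<beta> \<gamma>
      using biclosed_closed[OF bc _ B(1) that(1) turn[OF that(3,1,4)]] that by auto
    show "biclosed (insert (- s) (pos h - {s})) (B - {s})"
    proof (rule biclosedI)
      show "B - {s} \<subseteq> insert (- s) (pos h - {s})" using B by auto
    next
      fix \<alpha> \<beta> \<gamma> assume a: "\<alpha> \<in> B - {s}" "\<beta> \<in> B - {s}" "\<gamma> \<in> insert (- s) (pos h - {s})" "\<gamma> \<in> pos_span {\<alpha>, \<beta>}"
      then have "\<gamma> \<noteq> - s" using neg B by blast
      then show "\<gamma> \<in> B - {s}" using biclosed_closed[OF bc, of \<alpha> \<beta> \<gamma>] a by auto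
    next
      fix \<alpha> \<beta> \<gamma>
      assume a: "\<alpha> \<in> insert (- s) (pos h - {s}) - (B - {s})" "\<beta> \<in> insert (- s) (pos h - {s}) - (B - {s})"
        "\<gamma> \<in> B - {s}" "\<gamma> \<in> pos_span {\<alpha>, \<beta>}"
      have g: "\<gamma> \<in> pos h" using a B by auto
      consider "\<alpha> = - s" "\<beta> = - s" | "\<alpha> = - s" "\<beta> \<in> pos h - B" | "\<beta> = - s" "\<alpha> \<in> pos h - B"
        | "\<alpha> \<in> pos h - B" "\<beta> \<in> pos h - B" using a(1,2) by blast
      then show False
      proof cases
        case 1
        then obtain a b where ab: "a \<ge> 0" "b \<ge> 0" "\<gamma> = a *\<^sub>R (- s) + b *\<^sub>R (- s)"
          using a(4) unfolding pos_span_pair by auto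
        have "h \<gamma> = - (a * h s) - b * h s" by (subst ab(3)) (simp add: hl)
        moreover have "a * h s \<ge> 0" "b * h s \<ge> 0" using ab sp by (auto simp: pos_def)
        ultimately show False using g by (simp add: pos_def)
      next
        case 2
        then show False using main[of \<beta> \<gamma>] a g by auto
      next
        case 3
        then show False using main[of \<alpha> \<gamma>] a g pos_span_swap by blast
      next
        case 4
        then show False using biclosed_coclosed[OF bc, of \<alpha> \<beta> \<gamma>] a by auto
      qed
    qed
  }
  {
    assume bc: "biclosed (insert (- s) (pos h - {s})) (B - {s})"
    have main: "\<gamma> \<in> B" if "\<beta> \<in> B" "\<beta> \<noteq> s" "\<gamma> \<in> pos h" "\<gamma> \<in> pos_span {s, \<beta>}" for \<beta> \<gamma>
    proof (rule ccontr)
      assume n: "\<gamma> \<notin> B"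
      then have "\<gamma> \<noteq> s" using B by auto
      from biclosed_coclosed[OF bc _ _ _ _ turn'[OF that(3) this that(4)]] that n this ms ms' B
      show False by auto
    qed
    show "biclosed (pos h) B"
    proof (rule biclosedI[OF B(2)])
      fix \<alpha> \<beta> \<gamma> assume a: "\<alpha> \<in> B" "\<beta> \<in> B" "\<gamma> \<in> pos h" "\<gamma> \<in> pos_span {\<alpha>, \<beta>}"
      consider "\<gamma> = s" | "\<alpha> = s" "\<beta> = s" | "\<alpha> = s" "\<beta> \<noteq> s" | "\<beta> = s" "\<alpha> \<noteq> s" | "\<alpha> \<noteq> s" "\<beta> \<noteq> s" "\<gamma> \<noteq> s"
        by blast
      then show "\<gamma> \<in> B"
      proof cases
        case 2
        then obtain a b where "\<gamma> = (a + b) *\<^sub>R s"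
          using a(4) unfolding pos_span_pair by (auto simp: scaleR_left_distrib)
        then show ?thesis using pos_scale[OF h sp, of "a + b"] a(3) B by auto
      next
        case 3
        then show ?thesis using main[of \<beta> \<gamma>] a by auto
      next
        case 4
        then show ?thesis using main[of \<alpha> \<gamma>] a pos_span_swap by blast
      next
        case 5
        then show ?thesis using biclosed_closed[OF bc, of \<alpha> \<beta> \<gamma>] a by auto
      qed (use B in auto)
    next
      fix \<alpha> \<beta> \<gamma> assume a: "\<alpha> \<in> pos h - B" "\<beta> \<in> pos h - B" "\<gamma> \<in> B" "\<gamma> \<in> pos_span {\<alpha>, \<beta>}"
      have "\<gamma> \<noteq> s" using dec[of \<alpha> \<beta>] a B by auto
      then show False using biclosed_coclosed[OF bc, of \<alpha> \<beta> \<gamma>] a B by auto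
    qed
  }
qed

text \<open>The roots stay fixed and the positive system moves: replacing \<open>h\<close> by
  \<open>h \<circ> refl s\<close> for a simple \<open>s\<close> in \<open>Y\<close> deletes
  \<open>s\<close> from \<open>Y\<close> and \<open>Z\<close> and changes no other element. Hence
  the induction runs with \<open>h\<close> arbitrary.\<close>

lemma add_root_to_finite:
  assumes "finite Y" "height h" "biclosed (pos h) Y" "biclosed (pos h) Z" "Y \<subset> Z"
  shows "\<exists>y\<in>Z - Y. biclosed (pos h) (insert y Y)"
  using assms
proof (induction "card Y" arbitrary: Y Z h)
  case 0
  then have Y: "Y = {}" by simp
  have Z: "Z \<subseteq> pos h" "Z \<noteq> {}" using 0 biclosed_subset[OF 0(5)] by auto
  obtain s where s: "s \<in> Z" "simple h s"
    using ex_simple[OF 0(3) Z] biclosed_coclosed[OF 0(5)] by blast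
  then have sp: "s \<in> pos h" unfolding simple_def by auto
  have "biclosed (pos h) {s}"
  proof (rule biclosedI)
    fix \<alpha> \<beta> \<gamma> assume a: "\<alpha> \<in> {s}" "\<beta> \<in> {s}" "\<gamma> \<in> pos h" "\<gamma> \<in> pos_span {\<alpha>, \<beta>}"
    then obtain a b where "\<gamma> = (a + b) *\<^sub>R s"
      unfolding pos_span_pair by (auto simp: scaleR_left_distrib)
    then show "\<gamma> \<in> {s}" using pos_scale[OF 0(3) sp, of "a + b"] a(3) by auto
  next
    fix \<alpha> \<beta> \<gamma> assume "\<alpha> \<in> pos h - {s}" "\<beta> \<in> pos h - {s}" "\<gamma> \<in> {s}" "\<gamma> \<in> pos_span {\<alpha>, \<beta>}"
    then show False using s(2) unfolding simple_def by blast
  qed (use sp in auto)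
  then show ?case using Y s(1) by auto
next
  case (Suc n)
  then have Y: "Y \<subseteq> pos h" "Y \<noteq> {}" using biclosed_subset[OF Suc(5)] by auto
  obtain s where s: "s \<in> Y" "simple h s"
    using ex_simple[OF Suc(4) Y] biclosed_coclosed[OF Suc(5)] by blast
  note p = pos_refl[OF Suc(4) s(2)]
  have Zs: "s \<in> Z" "Z \<subseteq> pos h" using Suc(7) s biclosed_subset[OF Suc(6)] by auto
  have "\<exists>y\<in>(Z - {s}) - (Y - {s}). biclosed (pos (h \<circ> refl s)) (insert y (Y - {s}))"
  proof (rule Suc(1))
    show "n = card (Y - {s})" using Suc(2,3) s by simp
    show "biclosed (pos (h \<circ> refl s)) (Y - {s})" "biclosed (pos (h \<circ> refl s)) (Z - {s})"
      unfolding p using biclosed_flip[OF Suc(4) s(2)] Suc(5,6) s(1) Zs Y by blast+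
    show "finite (Y - {s})" using Suc(3) by simp
    show "height (h \<circ> refl s)" by (rule height_refl[OF Suc(4) s(2)])
    show "Y - {s} \<subset> Z - {s}" using Suc(7) s(1) Zs by blast
  qed
  then obtain y where y: "y \<in> Z" "y \<notin> Y" "y \<noteq> s" "biclosed (pos (h \<circ> refl s)) (insert y (Y - {s}))"
    using s(1) by blast
  have eq: "insert y (Y - {s}) = insert y Y - {s}" using y(3) by auto
  have "biclosed (pos h) (insert y Y)"
    using y(4) biclosed_flip[OF Suc(4) s(2), of "insert y Y"] s(1) Zs(2) y(1) Y(1)
    unfolding p eq by blast
  then show ?case using y(1,2) by blast
qed

end

section \<open>Finite root systems\<close>

lemma finite_root_systemD:
  assumes "finite_root_system \<Phi>"
  shows "finite \<Phi>" "\<alpha> \<in> \<Phi> \<Longrightarrow> \<alpha> \<noteq> 0"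
    "\<alpha> \<in> \<Phi> \<Longrightarrow> \<beta> \<in> \<Phi> \<Longrightarrow> \<beta> - (2 * (\<beta> \<bullet> \<alpha>) / (\<alpha> \<bullet> \<alpha>)) *\<^sub>R \<alpha> \<in> \<Phi>"
    "\<alpha> \<in> \<Phi> \<Longrightarrow> \<beta> \<in> \<Phi> \<Longrightarrow> 2 * (\<beta> \<bullet> \<alpha>) / (\<alpha> \<bullet> \<alpha>) \<in> \<int>"
    "\<alpha> \<in> \<Phi> \<Longrightarrow> c *\<^sub>R \<alpha> \<in> \<Phi> \<Longrightarrow> c = 1 \<or> c = -1"
  using assms unfolding finite_root_system_def by metis+

lemma finite_root_system_uminus:
  assumes "finite_root_system \<Phi>" "\<alpha> \<in> \<Phi>" shows "- \<alpha> \<in> \<Phi>"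
proof -
  have "\<alpha> - 2 *\<^sub>R \<alpha> \<in> \<Phi>"
    using finite_root_systemD(3)[OF assms(1,2,2)] finite_root_systemD(2)[OF assms] by simp
  then show ?thesis by (simp add: scaleR_2)
qed

lemma finite_root_system_crystal:
  assumes "finite_root_system \<Phi>" shows "crystal \<Phi> (\<lambda>x. x)"
  using finite_root_systemD[OF assms] linear_id unfolding id_def by unfold_locales auto

text \<open>Pairing the relation with \<alpha> and \<beta> gives an integral linear system for
  \<open>a\<close> and \<open>b\<close> with determinant 4 - u v, positive by strict Cauchy-Schwarz.
  By Cramer's rule this determinant is a common denominator.\<close>

lemma rational_coeffs:
  assumes R: "finite_root_system \<Phi>" and m: "\<alpha> \<in> \<Phi>" "\<beta> \<in> \<Phi>" "\<gamma> \<in> \<Phi>"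
    and g: "\<gamma> = a *\<^sub>R \<alpha> + b *\<^sub>R \<beta>" and n: "\<beta> \<noteq> \<alpha>" "\<beta> \<noteq> - \<alpha>"
  shows "\<exists>q::int. q > 0 \<and> of_int q * a \<in> \<int> \<and> of_int q * b \<in> \<int>"
proof -
  have ap: "\<alpha> \<bullet> \<alpha> > 0" "\<beta> \<bullet> \<beta> > 0" using finite_root_systemD(2)[OF R] m by auto
  obtain u v i j :: int where u: "2 * (\<beta> \<bullet> \<alpha>) / (\<alpha> \<bullet> \<alpha>) = u" and v: "2 * (\<alpha> \<bullet> \<beta>) / (\<beta> \<bullet> \<beta>) = v"
    and i: "2 * (\<gamma> \<bullet> \<alpha>) / (\<alpha> \<bullet> \<alpha>) = i" and j: "2 * (\<gamma> \<bullet> \<beta>) / (\<beta> \<bullet> \<beta>) = j"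
    using finite_root_systemD(4)[OF R] m by (meson Ints_cases)
  have "(\<alpha> \<bullet> \<beta>)\<^sup>2 \<noteq> (\<alpha> \<bullet> \<alpha>) * (\<beta> \<bullet> \<beta>)"
  proof
    assume e: "(\<alpha> \<bullet> \<beta>)\<^sup>2 = (\<alpha> \<bullet> \<alpha>) * (\<beta> \<bullet> \<beta>)"
    define c where "c = (\<alpha> \<bullet> \<beta>) / (\<alpha> \<bullet> \<alpha>)"
    have "(\<beta> - c *\<^sub>R \<alpha>) \<bullet> (\<beta> - c *\<^sub>R \<alpha>) = \<beta> \<bullet> \<beta> - 2 * c * (\<alpha> \<bullet> \<beta>) + c\<^sup>2 * (\<alpha> \<bullet> \<alpha>)"
      by (simp add: inner_diff_left inner_diff_right inner_commute power2_eq_square algebra_simps)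
    also have "\<dots> = 0" using e ap(1) unfolding c_def by (simp add: field_simps power2_eq_square)
    finally have "\<beta> = c *\<^sub>R \<alpha>" by simp
    then show False using finite_root_systemD(5)[OF R m(1), of c] m(2) n by auto
  qed
  then have "(\<alpha> \<bullet> \<beta>)\<^sup>2 < (\<alpha> \<bullet> \<alpha>) * (\<beta> \<bullet> \<beta>)" using Cauchy_Schwarz_ineq[of \<alpha> \<beta>] by simp
  then have "of_int (u * v) < (4::real)"
    using ap by (simp add: u[symmetric] v[symmetric] inner_commute field_simps power2_eq_square)
  then have uv: "4 - u * v > 0" by linarith
  have i': "of_int i = 2 * a + b * of_int u"
    using ap(1) unfolding i[symmetric] u[symmetric] g by (simp add: inner_add_left field_simps)
  have j': "of_int j = a * of_int v + 2 * b"
    using ap(2) unfolding j[symmetric] v[symmetric] g by (simp add: inner_add_left field_simps)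
  have "of_int (4 - u * v) * a = of_int (2 * i - u * j)" "of_int (4 - u * v) * b = of_int (2 * j - v * i)"
    by (simp_all add: i' j' algebra_simps)
  then have "of_int (4 - u * v) * a \<in> \<int>" "of_int (4 - u * v) * b \<in> \<int>" by (simp_all only: Ints_of_int)
  then show ?thesis using uv by blast
qed

section \<open>Finitely generated cones and the height of a base\<close>

lemma pos_span_finite:
  assumes "finite S"
  shows "x \<in> pos_span S \<longleftrightarrow> (\<exists>c. (\<forall>v\<in>S. c v \<ge> 0) \<and> x = (\<Sum>v\<in>S. c v *\<^sub>R v))"
proof
  assume "x \<in> pos_span S"
  then obtain T c where T: "T \<subseteq> S" "\<forall>v\<in>T. c v \<ge> 0" "x = (\<Sum>v\<in>T. c v *\<^sub>R v)"
    unfolding pos_span_def by auto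
  have "x = (\<Sum>v\<in>S. (if v \<in> T then c v else 0) *\<^sub>R v)"
    unfolding T(3) using T(1) assms by (intro sum.mono_neutral_cong_left) auto
  then show "\<exists>c. (\<forall>v\<in>S. c v \<ge> 0) \<and> x = (\<Sum>v\<in>S. c v *\<^sub>R v)"
    using T(2) by (intro exI[of _ "\<lambda>v. if v \<in> T then c v else 0"]) auto
qed (use assms in \<open>auto simp: pos_span_def\<close>)

lemma pos_span_add:
  assumes "finite S" "x \<in> pos_span S" "y \<in> pos_span S" shows "x + y \<in> pos_span S"
proof -
  obtain c d where "\<forall>v\<in>S. c v \<ge> 0" "x = (\<Sum>v\<in>S. c v *\<^sub>R v)" "\<forall>v\<in>S. d v \<ge> 0" "y = (\<Sum>v\<in>S. d v *\<^sub>R v)"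
    using assms unfolding pos_span_finite[OF assms(1)] by auto
  then show ?thesis unfolding pos_span_finite[OF assms(1)]
    by (intro exI[of _ "\<lambda>v. c v + d v"]) (auto simp: scaleR_left_distrib sum.distrib)
qed

lemma pos_span_scale:
  assumes "finite S" "x \<in> pos_span S" "0 \<le> a" shows "a *\<^sub>R x \<in> pos_span S"
proof -
  obtain c where "\<forall>v\<in>S. c v \<ge> 0" "x = (\<Sum>v\<in>S. c v *\<^sub>R v)"
    using assms unfolding pos_span_finite[OF assms(1)] by auto
  then show ?thesis unfolding pos_span_finite[OF assms(1)] using assms(3)
    by (intro exI[of _ "\<lambda>v. a * c v"]) (auto simp: scaleR_sum_right)
qed

lemma pos_span_superset: "x \<in> S \<Longrightarrow> x \<in> pos_span S"
  unfolding pos_span_def by (auto intro!: exI[of _ "{x}"] exI[of _ "\<lambda>_. 1"])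

lemma pos_span_mono: "S \<subseteq> T \<Longrightarrow> pos_span S \<subseteq> pos_span T"
  unfolding pos_span_def by blast

lemma pos_span_linear_nonneg:
  assumes "linear h" "\<And>v. v \<in> S \<Longrightarrow> h v \<ge> (0::real)" "x \<in> pos_span S" shows "h x \<ge> 0"
proof -
  obtain T c where T: "T \<subseteq> S" "\<forall>v\<in>T. c v \<ge> 0" "x = (\<Sum>v\<in>T. c v *\<^sub>R v)"
    using assms(3) unfolding pos_span_def by auto
  then have "h x = (\<Sum>v\<in>T. c v * h v)" by (simp add: linear_sum[OF assms(1)] linear_scale[OF assms(1)])
  then show ?thesis using T assms(2) by (auto intro!: sum_nonneg)
qed

text \<open>By independence the value 1 on \<open>S\<close> extends linearly. The height of a root
  is then the sum of its coefficients, which are integers of one sign and not all zero, so it is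
  nonzero and its sign is that of the root.\<close>

lemma base_height:
  assumes R: "finite_root_system \<Phi>" and B: "is_base \<Phi> S"
  obtains h :: "'v::euclidean_space \<Rightarrow> real" where "linear h" "\<And>s. s \<in> S \<Longrightarrow> h s = 1"
    "\<And>\<alpha>. \<alpha> \<in> \<Phi> \<Longrightarrow> h \<alpha> \<in> \<int> \<and> h \<alpha> \<noteq> 0" "\<And>\<alpha>. \<alpha> \<in> \<Phi> \<Longrightarrow> \<alpha> \<in> pos_span S \<longleftrightarrow> h \<alpha> > 0"
proof -
  have fin: "finite S" using B finite_root_systemD(1)[OF R] unfolding is_base_def by (meson finite_subset)
  obtain h :: "'v \<Rightarrow> real" where h: "linear h" "\<And>s. s \<in> S \<Longrightarrow> h s = 1"
    using B linear_independent_extend[of S "\<lambda>_. 1::real"] unfolding is_base_def by blast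
  have main: "h \<alpha> \<in> \<int> \<and> h \<alpha> \<noteq> 0 \<and> (\<alpha> \<in> pos_span S \<longleftrightarrow> h \<alpha> > 0)" if a: "\<alpha> \<in> \<Phi>" for \<alpha>
  proof -
    obtain c :: "'v \<Rightarrow> int" where c: "\<alpha> = (\<Sum>s\<in>S. of_int (c s) *\<^sub>R s)"
      and sg: "(\<forall>s\<in>S. c s \<ge> 0) \<or> (\<forall>s\<in>S. c s \<le> 0)" using B a unfolding is_base_def by meson
    have ha: "h \<alpha> = of_int (\<Sum>s\<in>S. c s)"
      by (subst c) (simp add: linear_sum[OF h(1)] linear_scale[OF h(1)] h(2))
    have m0: "(\<Sum>s\<in>S. c s) \<noteq> 0"
    proof
      assume "(\<Sum>s\<in>S. c s) = 0"
      then have "\<forall>s\<in>S. c s = 0"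
        using sg
      proof (elim disjE)
        assume "\<forall>s\<in>S. c s \<le> 0" "(\<Sum>s\<in>S. c s) = 0"
        then show ?thesis using sum_nonneg_eq_0_iff[OF fin, of "\<lambda>s. - c s"] by (simp add: sum_negf)
      qed (use sum_nonneg_eq_0_iff[OF fin, of c] in simp)
      then have "\<alpha> = 0" using c by simp
      then show False using finite_root_systemD(2)[OF R a] by simp
    qed
    have p1: "\<alpha> \<in> pos_span S" if "\<forall>s\<in>S. c s \<ge> 0"
      unfolding pos_span_finite[OF fin] using c that by (intro exI[of _ "\<lambda>s. of_int (c s)"]) auto
    have p2: "h \<alpha> \<ge> 0" if "\<alpha> \<in> pos_span S"
      by (rule pos_span_linear_nonneg[OF h(1) _ that]) (simp add: h(2))
    have p3: "(\<Sum>s\<in>S. c s) \<le> 0" if "\<forall>s\<in>S. c s \<le> 0" using that by (simp add: sum_nonpos)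
    have h0: "h \<alpha> \<noteq> 0" unfolding ha using m0 by (simp only: of_int_eq_0_iff not_False_eq_True)
    have "\<alpha> \<in> pos_span S" if "h \<alpha> > 0"
    proof -
      have "\<not> (\<Sum>s\<in>S. c s) \<le> 0" using that unfolding ha by (simp only: of_int_0_less_iff not_le)
      then show ?thesis using sg p1 p3 by blast
    qed
    moreover have "h \<alpha> \<in> \<int>" unfolding ha by (rule Ints_of_int)
    moreover have "h \<alpha> > 0" if "\<alpha> \<in> pos_span S" using p2[OF that] h0 by linarith
    ultimately show ?thesis using h0 by blast
  qed
  show ?thesis by (rule that[OF h]) (use main in auto)
qed

section \<open>Untwisted affine root systems\<close>

text \<open>\<open>p\<close> reads off the coefficient of \<delta>. The bound by
  \<open>h \<delta>\<close> gives h(\<alpha> + k\<delta>) the sign of \<open>k\<close> unless k = 0,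
  so \<open>h\<close> is positive exactly when k > 0, or k = 0 and \<alpha> has positive
  height.\<close>

locale affine_system =
  fixes \<Phi> :: "'v::euclidean_space set" and \<delta> :: 'v and p h :: "'v \<Rightarrow> real"
  assumes finite_system: "finite_root_system \<Phi>"
    and p: "linear p" "p \<delta> = 1" "\<alpha> \<in> \<Phi> \<Longrightarrow> p \<alpha> = 0"
    and h: "linear h" "\<alpha> \<in> \<Phi> \<Longrightarrow> h \<alpha> \<in> \<int> \<and> h \<alpha> \<noteq> 0 \<and> \<bar>h \<alpha>\<bar> < h \<delta>" "h \<delta> \<in> \<int>" "h \<delta> > 0"
begin

definition rt :: "'v \<Rightarrow> int \<Rightarrow> 'v" where "rt \<alpha> k = \<alpha> + of_int k *\<^sub>R \<delta>"
definition aff :: "'v set \<Rightarrow> 'v set" where "aff A = {rt \<alpha> k | \<alpha> k. \<alpha> \<in> A}"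
definition P :: "'v set" where "P = {x \<in> aff \<Phi>. h x > 0}"
definition proj :: "'v \<Rightarrow> 'v" where "proj x = x - p x *\<^sub>R \<delta>"
text \<open>The \<alpha> with this property form the set \<open>N\<close> of the idea above: what
  \<open>B\<close> looks like far out along \<delta>.\<close>

definition ev :: "'v set \<Rightarrow> 'v \<Rightarrow> bool" where "ev B \<alpha> \<longleftrightarrow> (\<exists>K. \<forall>k\<ge>K. rt \<alpha> k \<in> B)"

lemmas uminus_root = finite_root_system_uminus[OF finite_system]

lemma linear_proj: "linear proj"
  unfolding proj_def using p(1)
  by (intro linearI) (auto simp: linear_add linear_scale algebra_simps)

lemma p_rt: "\<alpha> \<in> \<Phi> \<Longrightarrow> p (rt \<alpha> k) = of_int k"
  by (simp add: rt_def linear_add[OF p(1)] linear_scale[OF p(1)] p)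

lemma proj_rt: "\<alpha> \<in> \<Phi> \<Longrightarrow> proj (rt \<alpha> k) = \<alpha>"
  by (simp add: proj_def p_rt) (simp add: rt_def)

lemma h_rt: "h (rt \<alpha> k) = h \<alpha> + of_int k * h \<delta>"
  by (simp add: rt_def linear_add[OF h(1)] linear_scale[OF h(1)])

lemma h_rt_pos_iff:
  assumes "\<alpha> \<in> \<Phi>"
  shows "h (rt \<alpha> k) > 0 \<longleftrightarrow> k > 0 \<or> k = 0 \<and> h \<alpha> > 0" and "h (rt \<alpha> k) \<noteq> 0"
proof -
  have b: "\<bar>h \<alpha>\<bar> < h \<delta>" "h \<alpha> \<noteq> 0" using h(2)[OF assms] by auto
  consider "k \<ge> 1" | "k = 0" | "k \<le> -1" by linarith
  then have "(h (rt \<alpha> k) > 0 \<longleftrightarrow> k > 0 \<or> k = 0 \<and> h \<alpha> > 0) \<and> h (rt \<alpha> k) \<noteq> 0"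
  proof cases
    case 1
    then have "of_int k * h \<delta> \<ge> 1 * h \<delta>" using h(4) by (intro mult_right_mono) auto
    then have "h (rt \<alpha> k) > 0" using b unfolding h_rt by linarith
    then show ?thesis using 1 by auto
  next
    case 3
    then have "of_int k \<le> (-1::real)" by linarith
    then have "of_int k * h \<delta> \<le> (-1) * h \<delta>" using h(4) by (intro mult_right_mono) auto
    then have "h (rt \<alpha> k) < 0" using b unfolding h_rt by linarith
    then show ?thesis using 3 by auto
  qed (use b in \<open>auto simp: h_rt\<close>)
  then show "h (rt \<alpha> k) > 0 \<longleftrightarrow> k > 0 \<or> k = 0 \<and> h \<alpha> > 0" "h (rt \<alpha> k) \<noteq> 0" by auto
qed

lemma rt_mem: "\<alpha> \<in> \<Phi> \<Longrightarrow> k \<ge> 1 \<Longrightarrow> rt \<alpha> k \<in> P"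
  unfolding P_def aff_def using h_rt_pos_iff by auto

lemma P_cases:
  assumes "x \<in> P" obtains k where "proj x \<in> \<Phi>" "k \<ge> 0" "x = rt (proj x) k"
proof -
  obtain \<alpha> k where "\<alpha> \<in> \<Phi>" "x = rt \<alpha> k" "h x > 0" using assms unfolding P_def aff_def by auto
  then show ?thesis using that[of k] h_rt_pos_iff(1)[of \<alpha> k] proj_rt[of \<alpha> k] by auto
qed

text \<open>Proved for a subset \<open>A\<close>, since \<open>add_root\<close> needs it for a
  subsystem. The reflection in \<alpha> + k\<delta> sends \<beta> + l\<delta> to (\<beta> -
  c\<alpha>) + (l - ck)\<delta>, where \<open>c\<close> is an integer.\<close>

lemma crystal_aff:
  assumes A: "A \<subseteq> \<Phi>" "\<And>\<alpha> \<beta>. \<alpha> \<in> A \<Longrightarrow> \<beta> \<in> A \<Longrightarrow> \<beta> - (2 * (\<beta> \<bullet> \<alpha>) / (\<alpha> \<bullet> \<alpha>)) *\<^sub>R \<alpha> \<in> A"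
  shows "crystal (aff A) proj"
proof (rule crystal.intro)
  show "linear proj" by (rule linear_proj)
  note D = finite_root_systemD[OF finite_system]
  show "proj x \<noteq> 0" if "x \<in> aff A" for x
    using that A(1) D(2) unfolding aff_def by (auto simp: proj_rt subset_iff)
  fix x y assume xy: "x \<in> aff A" "y \<in> aff A"
  then obtain \<alpha> k \<beta> l where x: "\<alpha> \<in> A" "x = rt \<alpha> k" and y: "\<beta> \<in> A" "y = rt \<beta> l" unfolding aff_def by auto
  have pr: "proj x = \<alpha>" "proj y = \<beta>" using x y A(1) proj_rt by auto
  obtain c :: int where c: "2 * (\<beta> \<bullet> \<alpha>) / (\<alpha> \<bullet> \<alpha>) = c"
    using D(4)[of \<alpha> \<beta>] x y A(1) by (auto elim!: Ints_cases)
  show "2 * (proj y \<bullet> proj x) / (proj x \<bullet> proj x) \<in> \<int>" using c pr by simp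
  have "\<beta> - of_int c *\<^sub>R \<alpha> \<in> A" using A(2)[OF x(1) y(1)] c by simp
  moreover have "y - of_int c *\<^sub>R x = rt (\<beta> - of_int c *\<^sub>R \<alpha>) (l - c * k)"
    unfolding x(2) y(2) rt_def by (simp add: algebra_simps)
  ultimately show "y - (2 * (proj y \<bullet> proj x) / (proj x \<bullet> proj x)) *\<^sub>R x \<in> aff A"
    using c pr unfolding aff_def by auto
next
  fix x and c :: real assume xy: "x \<in> aff A" "c *\<^sub>R x \<in> aff A"
  then obtain \<alpha> k \<beta> l where x: "\<alpha> \<in> A" "x = rt \<alpha> k" and y: "\<beta> \<in> A" "c *\<^sub>R x = rt \<beta> l" unfolding aff_def by auto
  have "\<beta> = proj (c *\<^sub>R x)" using y A(1) proj_rt by auto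
  also have "\<dots> = c *\<^sub>R \<alpha>" using x A(1) proj_rt by (auto simp: linear_scale[OF linear_proj])
  finally show "c = 1 \<or> c = -1"
    using finite_root_systemD(5)[OF finite_system, of \<alpha> c] x y A(1) by auto
qed

lemma height_aff:
  assumes "A \<subseteq> \<Phi>" "crystal (aff A) proj" shows "crystal.height (aff A) proj h"
  unfolding crystal.height_def[OF assms(2)]
proof (intro conjI ballI impI)
  fix x assume "x \<in> aff A"
  then obtain \<alpha> k where x: "\<alpha> \<in> \<Phi>" "x = rt \<alpha> k" using assms(1) unfolding aff_def by auto
  show "h x \<in> \<int>" using x h(2)[OF x(1)] h(3) by (auto simp: h_rt)
  show "h x \<noteq> 0" using x h_rt_pos_iff by auto
  fix y assume y': "y \<in> aff A" and e: "proj x = proj y" "h x = h y"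
  obtain \<beta> l where y: "\<beta> \<in> \<Phi>" "y = rt \<beta> l" using y' assms(1) unfolding aff_def by auto
  have "\<alpha> = \<beta>" using e x y proj_rt by auto
  then show "x = y" using e(2) h(4) unfolding x(2) y(2) h_rt by auto
qed (rule h(1))

lemma pos_aff: "A \<subseteq> \<Phi> \<Longrightarrow> crystal (aff A) proj \<Longrightarrow> crystal.pos (aff A) h = {x \<in> P. proj x \<in> A}"
  unfolding crystal.pos_def P_def aff_def by (auto simp: proj_rt subset_iff)

sublocale full: crystal "aff \<Phi>" proj
  by (rule crystal_aff) (use finite_root_systemD(3)[OF finite_system] in auto)

lemma full_pos: "full.pos h = P" and full_height: "full.height h"
  using full.crystal_axioms height_aff[of \<Phi>] unfolding full.pos_def P_def by auto

section \<open>Behaviour of biclosed sets far out along \<delta>\<close>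

lemma ev_dichotomy:
  assumes B: "biclosed P B" and a: "\<alpha> \<in> \<Phi>"
  shows "ev (P - B) \<alpha> \<longleftrightarrow> \<not> ev B \<alpha>"
proof
  assume "ev (P - B) \<alpha>"
  then obtain K where K: "\<And>k. k \<ge> K \<Longrightarrow> rt \<alpha> k \<in> P - B" unfolding ev_def by auto
  show "\<not> ev B \<alpha>"
  proof
    assume "ev B \<alpha>"
    then obtain L where "\<And>k. k \<ge> L \<Longrightarrow> rt \<alpha> k \<in> B" unfolding ev_def by auto
    then show False using K[of "max K L"] by auto
  qed
next
  assume n: "\<not> ev B \<alpha>"
  show "ev (P - B) \<alpha>"
  proof (rule ccontr)
    assume m: "\<not> ev (P - B) \<alpha>"
    \<comment> \<open>If neither set contains the string from some point on, three roots on it are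
      in, out and in \<open>B\<close> in this order, and the middle one lies in the cone of the
      outer two. Starting at 1 keeps them positive.\<close>
    obtain k1 where k1: "k1 \<ge> 1" "rt \<alpha> k1 \<notin> P - B" using m unfolding ev_def by blast
    obtain k2 where k2: "k2 \<ge> k1 + 1" "rt \<alpha> k2 \<notin> B" using n unfolding ev_def by blast
    obtain k3 where k3: "k3 \<ge> k2 + 1" "rt \<alpha> k3 \<notin> P - B" using m unfolding ev_def by blast
    have "of_int (k3 - k1) *\<^sub>R rt \<alpha> k2 = of_int (k3 - k2) *\<^sub>R rt \<alpha> k1 + of_int (k2 - k1) *\<^sub>R rt \<alpha> k3"
      by (simp add: rt_def algebra_simps)
    then have "rt \<alpha> k2 \<in> pos_span {rt \<alpha> k1, rt \<alpha> k3}"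
      by (rule pos_spanI2) (use k1 k2 k3 in auto)
    then have "rt \<alpha> k2 \<in> B"
      using biclosed_closed[OF B, of "rt \<alpha> k1" "rt \<alpha> k3" "rt \<alpha> k2"]
        rt_mem[OF a, of k1] rt_mem[OF a, of k2] rt_mem[OF a, of k3] k1 k2 k3 by auto
    then show False using k2 by simp
  qed
qed

text \<open>By \<open>ev_dichotomy\<close> it is enough to find members of \<open>B\<close>
  arbitrarily far along the string of \<gamma>. With denominators cleared to q\<gamma> = r\<alpha> +
  s\<beta>, the root \<gamma> + (r+s)M\<delta> lies in the cone of \<alpha> + qM\<delta> and \<beta>
  + qM\<delta> for every \<open>M\<close>. Reducedness settles proportional \<alpha> and
  \<beta>.\<close>

lemma ev_closed:
  assumes B: "biclosed P B" and m: "\<alpha> \<in> \<Phi>" "\<beta> \<in> \<Phi>" "\<gamma> \<in> \<Phi>" "\<gamma> \<in> pos_span {\<alpha>, \<beta>}"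
    and ev: "ev B \<alpha>" "ev B \<beta>"
  shows "ev B \<gamma>"
proof -
  note D = finite_root_systemD[OF finite_system]
  obtain a b where ab: "a \<ge> 0" "b \<ge> 0" "\<gamma> = a *\<^sub>R \<alpha> + b *\<^sub>R \<beta>"
    using m(4) unfolding pos_span_pair by auto
  consider "\<beta> = \<alpha>" | "\<beta> = - \<alpha>" | "\<beta> \<noteq> \<alpha>" "\<beta> \<noteq> - \<alpha>" by blast
  then show ?thesis
  proof cases
    case 1
    then have "\<gamma> = (a + b) *\<^sub>R \<alpha>" using ab by (simp add: scaleR_left_distrib)
    then show ?thesis using D(5)[OF m(1), of "a + b"] m(3) ab(1,2) ev by auto
  next
    case 2
    then have "\<gamma> = (a - b) *\<^sub>R \<alpha>" using ab by (simp add: scaleR_left_diff_distrib)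
    then show ?thesis using D(5)[OF m(1), of "a - b"] m(3) 2 ev by auto
  next
    case 3
    obtain q :: int where q: "q > 0" "of_int q * a \<in> \<int>" "of_int q * b \<in> \<int>"
      using rational_coeffs[OF finite_system m(1-3) ab(3) 3] by auto
    then obtain r s :: int where rs: "of_int q * a = r" "of_int q * b = s" by (auto elim!: Ints_cases)
    have rs0: "r \<ge> 0" "s \<ge> 0" using rs ab q(1) by (metis mult_nonneg_nonneg of_int_0_le_iff less_imp_le)+
    have g: "of_int q *\<^sub>R \<gamma> = of_int r *\<^sub>R \<alpha> + of_int s *\<^sub>R \<beta>"
      unfolding ab(3) rs[symmetric] by (simp add: scaleR_add_right)
    have "r + s \<noteq> 0"
    proof
      assume "r + s = 0"
      then have "r = 0" "s = 0" using rs0 by auto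
      then show False using g D(2)[OF m(3)] q(1) by auto
    qed
    then have rs1: "r + s \<ge> 1" using rs0 by auto
    show ?thesis
    proof (rule ccontr)
      assume "\<not> ev B \<gamma>"
      then obtain Kg where Kg: "\<And>k. k \<ge> Kg \<Longrightarrow> rt \<gamma> k \<in> P - B"
        using ev_dichotomy[OF B m(3)] unfolding ev_def by auto
      obtain Ka Kb where K: "\<And>k. k \<ge> Ka \<Longrightarrow> rt \<alpha> k \<in> B" "\<And>k. k \<ge> Kb \<Longrightarrow> rt \<beta> k \<in> B"
        using ev unfolding ev_def by auto
      define M where "M = max 1 (max Kg (max Ka Kb))"
      have M: "M \<ge> 1" "M \<ge> Kg" "M \<ge> Ka" "M \<ge> Kb" unfolding M_def by auto
      have big: "q * M \<ge> M" "(r + s) * M \<ge> M"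
        using mult_right_mono[of 1 q M] mult_right_mono[of 1 "r + s" M] q(1) rs1 M(1) by auto
      have "of_int q *\<^sub>R rt \<gamma> ((r + s) * M) = of_int r *\<^sub>R rt \<alpha> (q * M) + of_int s *\<^sub>R rt \<beta> (q * M)"
        unfolding rt_def scaleR_add_right g by (simp add: algebra_simps)
      then have "rt \<gamma> ((r + s) * M) \<in> pos_span {rt \<alpha> (q * M), rt \<beta> (q * M)}"
        by (rule pos_spanI2) (use rs0 q(1) in auto)
      then have "rt \<gamma> ((r + s) * M) \<in> B"
        by (rule biclosed_closed[OF B K(1) K(2), rotated -1]) (use Kg[OF order_trans[OF M(2) big(2)]] order_trans[OF M(3) big(1)] order_trans[OF M(4) big(1)] in auto)
      then show False using Kg[OF order_trans[OF M(2) big(2)]] by simp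
    qed
  qed
qed

lemma ev_coclosed:
  assumes "biclosed P B" "\<alpha> \<in> \<Phi>" "\<beta> \<in> \<Phi>" "\<gamma> \<in> \<Phi>" "\<gamma> \<in> pos_span {\<alpha>, \<beta>}" "\<not> ev B \<alpha>" "\<not> ev B \<beta>"
  shows "\<not> ev B \<gamma>"
  using ev_closed[OF biclosed_complement[OF assms(1)] assms(2-5)] assms ev_dichotomy by auto

text \<open>Let \<alpha> be the projection of \<open>x\<close>. If \<open>x\<close> were outside
  \<open>B\<close>, so would be all positive roots in the cone of \<open>x\<close> and -\<alpha> +
  j\<delta> for large \<open>j\<close>; but this cone contains \<alpha> + l\<delta> for large
  \<open>l\<close>.\<close>

lemma ev_one_sided:
  assumes B: "biclosed P B" and x: "x \<in> P" and ev: "ev B (proj x)" "\<not> ev B (- proj x)"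
  shows "x \<in> B"
proof (rule ccontr)
  assume n: "x \<notin> B"
  obtain k where k: "proj x \<in> \<Phi>" "x = rt (proj x) k" using P_cases[OF x] by blast
  define \<alpha> where "\<alpha> = proj x"
  note k = k[folded \<alpha>_def] and ev = ev[folded \<alpha>_def]
  obtain K where K: "\<And>k. k \<ge> K \<Longrightarrow> rt \<alpha> k \<in> B" using ev unfolding ev_def by auto
  obtain J where J: "\<And>k. k \<ge> J \<Longrightarrow> rt (- \<alpha>) k \<in> P - B"
    using ev(2) ev_dichotomy[OF B uminus_root[OF k(1)]] unfolding ev_def by auto
  \<comment> \<open>Besides being large, \<open>j\<close> and \<open>l\<close> satisfy j \<ge> 1 - k
    and l \<ge> k, which gives the relation below the right signs.\<close>
  define j where "j = max J (1 - k)"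
  define l where "l = max K k"
  have jl: "j \<ge> J" "k + j \<ge> 1" "l \<ge> K" "l \<ge> k" unfolding j_def l_def by auto
  have "of_int (k + j) *\<^sub>R rt \<alpha> l = of_int (j + l) *\<^sub>R x + of_int (l - k) *\<^sub>R rt (- \<alpha>) j"
    unfolding k(2) rt_def by (simp add: algebra_simps)
  then have "rt \<alpha> l \<in> pos_span {x, rt (- \<alpha>) j}"
    by (rule pos_spanI2) (use jl in auto)
  then have "rt \<alpha> l \<notin> B" using biclosed_coclosed[OF B x n] J[OF jl(1)] by auto
  then show False using K[OF jl(3)] by simp
qed

lemma ev_one_sided':
  assumes B: "biclosed P B" and x: "x \<in> P" and ev: "\<not> ev B (proj x)" "ev B (- proj x)"
  shows "x \<notin> B"
proof -
  have "proj x \<in> \<Phi>" using P_cases[OF x] by blast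
  then have "x \<in> P - B"
    using ev_one_sided[OF biclosed_complement[OF B] x] ev ev_dichotomy[OF B] uminus_root by auto
  then show ?thesis by simp
qed

text \<open>A root \<open>y\<close> that can be added within the subsystem can be added to
  \<open>B1\<close>, because relations between \<open>y\<close> and roots outside the subsystem are
  decided by \<open>ev B1\<close>: \<open>ev_closed\<close> and \<open>ev_coclosed\<close> settle
  the projections, and \<open>ev_one_sided\<close> transfers this to the affine roots.\<close>

lemma add_root:
  assumes B: "biclosed P B1" "biclosed P B2" "B1 \<subseteq> B2"
    and x: "x \<in> B2 - B1" "\<not> ev B1 (proj x)" "\<not> ev B1 (- proj x)"
  shows "\<exists>y\<in>B2 - B1. biclosed P (insert y B1)"
proof -
  define \<Phi>' where "\<Phi>' = {\<alpha> \<in> \<Phi>. \<not> ev B1 \<alpha> \<and> \<not> ev B1 (- \<alpha>)}"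
  define Q where "Q = {x \<in> P. proj x \<in> \<Phi>'}"
  have sub: "\<Phi>' \<subseteq> \<Phi>" "Q \<subseteq> P" unfolding \<Phi>'_def Q_def by auto
  note um = uminus_root
  have um': "\<alpha> \<in> \<Phi>' \<Longrightarrow> - \<alpha> \<in> \<Phi>'" for \<alpha> using um unfolding \<Phi>'_def by auto
  have neg_span: "- u \<in> pos_span {- v, - w}" if "u \<in> pos_span {v, w}" for u v w :: 'v
    using that unfolding pos_span_pair by (metis minus_add_distrib scaleR_minus_right)
  \<comment> \<open>Coclosedness of \<open>ev B1\<close> is applied to both \<gamma> and
    -\<gamma>.\<close>
  have closed': "\<gamma> \<in> \<Phi>'" if "\<alpha> \<in> \<Phi>'" "\<beta> \<in> \<Phi>'" "\<gamma> \<in> \<Phi>" "\<gamma> \<in> pos_span {\<alpha>, \<beta>}" for \<alpha> \<beta> \<gamma>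
    using ev_coclosed[OF B(1) _ _ that(3,4)] ev_coclosed[OF B(1) _ _ um[OF that(3)] neg_span[OF that(4)]]
      that um unfolding \<Phi>'_def by auto
  have cr: "crystal (aff \<Phi>') proj"
  proof (rule crystal_aff[OF sub(1)])
    fix \<alpha> \<beta> assume a: "\<alpha> \<in> \<Phi>'" "\<beta> \<in> \<Phi>'"
    define c where "c = 2 * (\<beta> \<bullet> \<alpha>) / (\<alpha> \<bullet> \<alpha>)"
    have m: "\<beta> - c *\<^sub>R \<alpha> \<in> \<Phi>"
      using finite_root_systemD(3)[OF finite_system] a sub unfolding c_def by auto
    show "\<beta> - (2 * (\<beta> \<bullet> \<alpha>) / (\<alpha> \<bullet> \<alpha>)) *\<^sub>R \<alpha> \<in> \<Phi>'" unfolding c_def[symmetric]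
    proof (cases "c \<ge> 0")
      case True
      show "\<beta> - c *\<^sub>R \<alpha> \<in> \<Phi>'"
        by (rule closed'[OF a(2) um'[OF a(1)] m], rule pos_spanI[of _ 1 _ c]) (use True in auto)
    next
      case False
      show "\<beta> - c *\<^sub>R \<alpha> \<in> \<Phi>'"
        by (rule closed'[OF a(2,1) m], rule pos_spanI[of _ 1 _ "- c"]) (use False in auto)
    qed
  qed
  have posQ: "crystal.pos (aff \<Phi>') h = Q" unfolding Q_def by (rule pos_aff[OF sub(1) cr])
  have "finite (B1 \<inter> Q)"
  proof -
    \<comment> \<open>By \<open>ev_dichotomy\<close>, \<open>B1\<close> misses each string over the
      subsystem from some point on, and there are finitely many strings.\<close>
    have "\<exists>K. \<forall>k\<ge>K. rt \<alpha> k \<notin> B1" if "\<alpha> \<in> \<Phi>'" for \<alpha>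
      using that ev_dichotomy[OF B(1), of \<alpha>] unfolding \<Phi>'_def ev_def by auto
    then obtain K where K: "\<And>\<alpha> k. \<alpha> \<in> \<Phi>' \<Longrightarrow> k \<ge> K \<alpha> \<Longrightarrow> rt \<alpha> k \<notin> B1" by metis
    have "B1 \<inter> Q \<subseteq> (\<Union>\<alpha>\<in>\<Phi>'. rt \<alpha> ` {0..K \<alpha>})"
    proof
      fix z assume z: "z \<in> B1 \<inter> Q"
      then obtain k where k: "k \<ge> 0" "z = rt (proj z) k" using P_cases[of z] sub by blast
      then have "k \<le> K (proj z)" using K[of "proj z" k] z unfolding Q_def by force
      then show "z \<in> (\<Union>\<alpha>\<in>\<Phi>'. rt \<alpha> ` {0..K \<alpha>})" using k z unfolding Q_def by force
    qed
    moreover have "finite \<Phi>'" using sub(1) finite_root_systemD(1)[OF finite_system] by (rule finite_subset)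
    ultimately show ?thesis by (meson finite_UN finite_imageI finite_atLeastAtMost_int finite_subset)
  qed
  moreover have "x \<in> Q"
    using x biclosed_subset[OF B(2)] P_cases[of x] unfolding Q_def \<Phi>'_def by blast
  then have "B1 \<inter> Q \<subset> B2 \<inter> Q" using x B(3) by auto
  ultimately obtain y where y: "y \<in> B2" "y \<in> Q" "y \<notin> B1" and yQ: "biclosed Q (insert y (B1 \<inter> Q))"
    using crystal.add_root_to_finite[OF cr, of "B1 \<inter> Q" h "B2 \<inter> Q"] height_aff[OF sub(1) cr]
      biclosed_restrict[OF B(1) sub(2)] biclosed_restrict[OF B(2) sub(2)] unfolding posQ by blast
  have inQ: "z \<in> Q \<longleftrightarrow> proj z \<in> \<Phi>'" if "z \<in> P" for z using that unfolding Q_def by auto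
  have prP: "proj z \<in> \<Phi>" if "z \<in> P" for z using P_cases[OF that] by blast
  note pl = linear_add[OF linear_proj] linear_scale[OF linear_proj]
  have proj_span: "proj z \<in> pos_span {proj v, proj w}" if "z \<in> pos_span {v, w}" for z v w
    using that unfolding pos_span_pair by (metis pl)
  have yP: "y \<in> P" using y sub by auto
  have uu: "proj y \<in> \<Phi>'" using y unfolding Q_def by auto
  \<comment> \<open>If \<beta> projects into the subsystem, so does \<gamma>, and the relation lives
    in \<open>Q\<close>. Otherwise \<open>ev B1\<close> holds at the projection of \<beta>, and
    unless \<gamma> is \<open>y\<close> or \<beta>, it follows that \<open>ev B1\<close> holds at
    the projection of \<gamma> and fails at its negative.\<close>
  have up: "\<gamma> \<in> insert y B1"
    if b: "\<beta> \<in> B1" and g: "\<gamma> \<in> P" "\<gamma> \<in> pos_span {y, \<beta>}" for \<beta> \<gamma>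
  proof (cases "proj \<beta> \<in> \<Phi>'")
    case True
    then have bQ: "\<beta> \<in> Q" using b biclosed_subset[OF B(1)] inQ by auto
    have "\<gamma> \<in> Q" using inQ[OF g(1)] closed'[OF uu True prP[OF g(1)] proj_span[OF g(2)]] by simp
    then show ?thesis using biclosed_closed[OF yQ, of y \<beta> \<gamma>] g b bQ by auto
  next
    case False
    have bP: "\<beta> \<in> P" using b biclosed_subset[OF B(1)] by auto
    have Nb: "ev B1 (proj \<beta>)"
    proof (rule ccontr)
      assume n: "\<not> ev B1 (proj \<beta>)"
      then have "ev B1 (- proj \<beta>)" using False prP[OF bP] unfolding \<Phi>'_def by auto
      then show False using ev_one_sided'[OF B(1) bP n] b by simp
    qed
    show ?thesis
    proof (cases "\<gamma> = y \<or> \<gamma> = \<beta>")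
      case False
      then obtain a c where ac: "a > 0" "c > 0" "\<gamma> = a *\<^sub>R y + c *\<^sub>R \<beta>"
        using full.pos_span_coeffs[OF full_height, unfolded full_pos, OF yP bP g(1) _ _ g(2)] by blast
      have pg: "proj \<gamma> = a *\<^sub>R proj y + c *\<^sub>R proj \<beta>" by (subst ac(3)) (simp add: pl)
      \<comment> \<open>The relation solved for \<open>- proj y\<close> would give
        \<open>ev B1\<close> there, which the subsystem excludes.\<close>
      have n1: "\<not> ev B1 (- proj \<gamma>)"
      proof
        assume e: "ev B1 (- proj \<gamma>)"
        have "a *\<^sub>R (- proj y) = 1 *\<^sub>R (- proj \<gamma>) + c *\<^sub>R proj \<beta>" by (simp add: pg)
        then have "- proj y \<in> pos_span {- proj \<gamma>, proj \<beta>}" by (rule pos_spanI2) (use ac(1,2) in auto)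
        then have "ev B1 (- proj y)"
          using ev_closed[OF B(1) _ _ _ _ e Nb] um prP g bP yP by blast
        then show False using uu unfolding \<Phi>'_def by auto
      qed
      have "ev B1 (proj \<gamma>)"
      proof (rule ccontr)
        assume e: "\<not> ev B1 (proj \<gamma>)"
        have "c *\<^sub>R proj \<beta> = 1 *\<^sub>R proj \<gamma> + a *\<^sub>R (- proj y)" by (simp add: pg)
        then have sp: "proj \<beta> \<in> pos_span {proj \<gamma>, - proj y}" by (rule pos_spanI2) (use ac(1,2) in auto)
        have "\<not> ev B1 (- proj y)" using uu unfolding \<Phi>'_def by auto
        then show False
          using ev_coclosed[OF B(1) _ _ _ sp e] um prP g bP yP Nb by blast
      qed
      then show ?thesis using ev_one_sided[OF B(1) g(1) _ n1] by simp
    qed (use b in auto)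
  qed
  have down: "ev B1 (- proj \<alpha>)" if a: "\<alpha> \<in> P" "\<alpha> \<notin> B1" "proj \<alpha> \<notin> \<Phi>'" for \<alpha>
    using a prP[OF a(1)] ev_one_sided[OF B(1) a(1)] unfolding \<Phi>'_def by auto
  have "biclosed P (insert y B1)"
  proof (rule biclosedI)
    show "insert y B1 \<subseteq> P" using yP biclosed_subset[OF B(1)] by simp
  next
    fix \<alpha> \<beta> \<gamma> assume a: "\<alpha> \<in> insert y B1" "\<beta> \<in> insert y B1" "\<gamma> \<in> P" "\<gamma> \<in> pos_span {\<alpha>, \<beta>}"
    consider "\<alpha> = y" "\<beta> = y" | "\<alpha> = y" "\<beta> \<in> B1" | "\<beta> = y" "\<alpha> \<in> B1" | "\<alpha> \<in> B1" "\<beta> \<in> B1" using a by blast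
    then show "\<gamma> \<in> insert y B1"
    proof cases
      case 1
      have "\<gamma> \<in> Q" using inQ[OF a(3)] closed'[OF uu uu prP[OF a(3)]] proj_span[OF a(4)] 1 by simp
      then show ?thesis using biclosed_closed[OF yQ, of y y \<gamma>] a 1 by auto
    next
      case 2
      then show ?thesis using up[of \<beta> \<gamma>] a by simp
    next
      case 3
      then show ?thesis using up[of \<alpha> \<gamma>] a pos_span_swap[of \<alpha> \<beta>] by simp
    next
      case 4
      then show ?thesis using biclosed_closed[OF B(1) _ _ a(3,4)] by simp
    qed
  next
    fix \<alpha> \<beta> \<gamma>
    assume a: "\<alpha> \<in> P - insert y B1" "\<beta> \<in> P - insert y B1" "\<gamma> \<in> insert y B1" "\<gamma> \<in> pos_span {\<alpha>, \<beta>}"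
    then have g: "\<gamma> = y" using biclosed_coclosed[OF B(1), of \<alpha> \<beta> \<gamma>] by auto
    obtain c d where cd: "c > 0" "d > 0" "y = c *\<^sub>R \<alpha> + d *\<^sub>R \<beta>"
      using full.pos_span_coeffs[OF full_height, unfolded full_pos, of \<alpha> \<beta> y] a g yP by auto
    have pg: "proj y = c *\<^sub>R proj \<alpha> + d *\<^sub>R proj \<beta>" by (subst cd(3)) (simp add: pl)
    have ab: "proj \<alpha> \<in> \<Phi>" "proj \<beta> \<in> \<Phi>" using prP a by auto
    \<comment> \<open>The relation for \<open>proj y\<close> can be solved for either summand, and
      the subsystem contains the negatives of its roots and all roots in its two-root cones.\<close>
    have both: "proj \<alpha> \<in> \<Phi>' \<longleftrightarrow> proj \<beta> \<in> \<Phi>'"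
    proof
      assume r: "proj \<alpha> \<in> \<Phi>'"
      have "d *\<^sub>R proj \<beta> = 1 *\<^sub>R proj y + c *\<^sub>R (- proj \<alpha>)" by (simp add: pg)
      then have "proj \<beta> \<in> pos_span {proj y, - proj \<alpha>}" by (rule pos_spanI2) (use cd(1,2) in auto)
      then show "proj \<beta> \<in> \<Phi>'" by (rule closed'[OF uu um'[OF r] ab(2)])
    next
      assume r: "proj \<beta> \<in> \<Phi>'"
      have "c *\<^sub>R proj \<alpha> = 1 *\<^sub>R proj y + d *\<^sub>R (- proj \<beta>)" by (simp add: pg)
      then have "proj \<alpha> \<in> pos_span {proj y, - proj \<beta>}" by (rule pos_spanI2) (use cd(1,2) in auto)
      then show "proj \<alpha> \<in> \<Phi>'" by (rule closed'[OF uu um'[OF r] ab(1)])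
    qed
    show False
    proof (cases "proj \<alpha> \<in> \<Phi>'")
      case True
      then have "\<alpha> \<in> Q" "\<beta> \<in> Q" using both inQ a by auto
      then show False using biclosed_coclosed[OF yQ, of \<alpha> \<beta> y] a g by auto
    next
      case False
      then have "ev B1 (- proj \<alpha>)" "ev B1 (- proj \<beta>)" using down both a by auto
      then have "ev B1 (- proj y)"
        using ev_closed[OF B(1) um[OF ab(1)] um[OF ab(2)] um[OF prP[OF yP]]
            neg_span[OF proj_span]] a(4) g by blast
      then show False using uu unfolding \<Phi>'_def by auto
    qed
  qed
  then show ?thesis using y by blast
qed

lemma add_or_remove_root:
  assumes B: "biclosed P B1" "biclosed P B2" "B1 \<subset> B2"
  shows "\<exists>y\<in>B2 - B1. biclosed P (insert y B1) \<or> biclosed P (B2 - {y})"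
proof -
  obtain x where x: "x \<in> B2 - B1" using B(3) by auto
  have sub: "B1 \<subseteq> P" "B2 \<subseteq> P" using B biclosed_subset by auto
  have xP: "x \<in> P" using x sub by auto
  have a: "proj x \<in> \<Phi>" "- proj x \<in> \<Phi>" using P_cases[OF xP] uminus_root by blast+
  note c = ev_dichotomy[OF B(2) a(1)] ev_dichotomy[OF B(2) a(2)]
  have mono: "ev B2 \<alpha>" if "ev B1 \<alpha>" for \<alpha> using that B(3) unfolding ev_def by blast
  \<comment> \<open>The second case is the first one for the complements. In the last two,
    \<open>ev_one_sided\<close> and its dual would put \<open>x\<close> into \<open>B1\<close> or
    keep it out of \<open>B2\<close>.\<close>
  consider "\<not> ev B1 (proj x)" "\<not> ev B1 (- proj x)" | "ev B2 (proj x)" "ev B2 (- proj x)"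
    | "ev B1 (proj x)" "\<not> ev B1 (- proj x)" | "ev B1 (- proj x)" "\<not> ev B2 (proj x)"
    using mono by blast
  then show ?thesis
  proof cases
    case 1
    then show ?thesis using add_root[OF B(1,2) _ x] B(3) by blast
  next
    case 2
    have "\<exists>y\<in>(P - B1) - (P - B2). biclosed P (insert y (P - B2))"
      by (rule add_root[of _ _ x]) (use 2 c B x xP biclosed_complement in auto)
    then obtain y where y: "y \<in> B2 - B1" "biclosed P (insert y (P - B2))" using sub by auto
    have "P - insert y (P - B2) = B2 - {y}" using sub by auto
    then show ?thesis using y biclosed_complement[OF y(2)] by auto
  next
    case 3
    then show ?thesis using ev_one_sided[OF B(1) xP] x by auto
  next
    case 4
    then show ?thesis using ev_one_sided'[OF B(2) xP] x mono by auto
  qed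
qed

end

section \<open>The affine positive system cut out by a height\<close>

lemma affine_positive_roots_system:
  assumes "affine_positive_roots (P :: 'v::euclidean_space set)"
  obtains \<Phi> \<delta> p h where "affine_system \<Phi> \<delta> p h" "affine_system.P \<Phi> \<delta> h = P"
proof -
  obtain \<Phi> S \<theta> and \<delta> :: 'v where R: "finite_root_system \<Phi>" and B: "is_base \<Phi> S" and t: "\<theta> \<in> \<Phi>"
    and hi: "\<forall>\<beta>\<in>\<Phi>. \<theta> - \<beta> \<in> pos_span S" and d: "\<delta> \<notin> span \<Phi>"
    and P: "P = {\<alpha> + of_int k *\<^sub>R \<delta> | \<alpha> k. \<alpha> \<in> \<Phi>} \<inter> pos_span (S \<union> {\<delta> - \<theta>})"
    using assms unfolding affine_positive_roots_def by blast
  have fin: "finite S" using B finite_root_systemD(1)[OF R] unfolding is_base_def by (meson finite_subset)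
  note um = finite_root_system_uminus[OF R]
  \<comment> \<open>As \<delta> is outside the span of \<Phi>, its component \<open>w\<close>
    orthogonal to that span is nonzero; pairing with \<open>w\<close>, normalised at \<delta>, gives
    \<open>p\<close>.\<close>
  obtain u w where uw: "\<delta> = u + w" "u \<in> span \<Phi>" "\<And>x. x \<in> span \<Phi> \<Longrightarrow> orthogonal w x"
    using orthogonal_subspace_decomp_exists[of \<Phi> \<delta>] by metis
  have w0: "w \<bullet> w \<noteq> 0" using d uw by auto
  define p where "p x = (x \<bullet> w) / (w \<bullet> w)" for x
  have p: "linear p" "p \<delta> = 1" "\<And>\<alpha>. \<alpha> \<in> \<Phi> \<Longrightarrow> p \<alpha> = 0"
  proof -
    show "linear p" unfolding p_def by (intro linearI) (auto simp: inner_add_left add_divide_distrib)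
    have "u \<bullet> w = 0" using uw(3)[OF uw(2)] by (simp add: orthogonal_def inner_commute)
    then show "p \<delta> = 1" using w0 unfolding p_def uw(1) by (simp add: inner_add_left)
    show "p \<alpha> = 0" if "\<alpha> \<in> \<Phi>" for \<alpha>
      using uw(3)[of \<alpha>] that unfolding p_def by (simp add: span_base orthogonal_def inner_commute)
  qed
  obtain g :: "'v \<Rightarrow> real" where g: "linear g" "\<And>s. s \<in> S \<Longrightarrow> g s = 1"
    "\<And>\<alpha>. \<alpha> \<in> \<Phi> \<Longrightarrow> g \<alpha> \<in> \<int> \<and> g \<alpha> \<noteq> 0" "\<And>\<alpha>. \<alpha> \<in> \<Phi> \<Longrightarrow> \<alpha> \<in> pos_span S \<longleftrightarrow> g \<alpha> > 0"
    using base_height[OF R B] by metis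
  \<comment> \<open>The correction leaves \<open>g\<close> unchanged on \<Phi> and gives \<delta> -
    \<theta> the value 1, so \<open>h\<close> is the height of the affine base. As \<theta> is
    highest, \<open>h \<delta>\<close>, which is \<open>1 + g \<theta>\<close>, exceeds all heights
    on \<Phi>.\<close>
  define h where "h x = g x + p x * (1 + g \<theta> - g \<delta>)" for x
  have hl: "linear h" unfolding h_def
    by (intro linearI) (auto simp: linear_add[OF g(1)] linear_scale[OF g(1)] linear_add[OF p(1)]
        linear_scale[OF p(1)] algebra_simps)
  have hP: "h \<alpha> = g \<alpha>" if "\<alpha> \<in> \<Phi>" for \<alpha> using p(3)[OF that] by (simp add: h_def)
  have hd: "h \<delta> = 1 + g \<theta>" using p(2) by (simp add: h_def)
  have le: "g \<beta> \<le> g \<theta>" if "\<beta> \<in> \<Phi>" for \<beta>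
    using pos_span_linear_nonneg[OF g(1), of S "\<theta> - \<beta>"] hi that g(2) by (simp add: linear_diff[OF g(1)])
  have le': "\<bar>g \<beta>\<bar> \<le> g \<theta>" if "\<beta> \<in> \<Phi>" for \<beta>
    using le[OF that] le[OF um[OF that]] by (simp add: linear_neg[OF g(1)])
  interpret affine_system \<Phi> \<delta> p h
  proof (rule affine_system.intro)
    show "h \<alpha> \<in> \<int> \<and> h \<alpha> \<noteq> 0 \<and> \<bar>h \<alpha>\<bar> < h \<delta>" if "\<alpha> \<in> \<Phi>" for \<alpha>
      using g(3)[OF that] le'[OF that] hP[OF that] hd by auto
    show "h \<delta> \<in> \<int>" using hd g(3)[OF t] by simp
    show "h \<delta> > 0" using hd le'[OF t] by linarith
  qed (use R p hl in simp_all)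
  let ?S = "S \<union> {\<delta> - \<theta>}"
  have finS: "finite ?S" using fin by simp
  have up: "x \<in> pos_span ?S" if "x \<in> pos_span S" for x using that pos_span_mono[of S ?S] by auto
  have h_nonneg: "h x \<ge> 0" if "x \<in> pos_span ?S" for x
  proof (rule pos_span_linear_nonneg[OF hl _ that])
    fix v assume "v \<in> ?S"
    moreover have "S \<subseteq> \<Phi>" using B unfolding is_base_def by auto
    ultimately show "h v \<ge> 0" using g(2) hP hd t by (auto simp: linear_diff[OF hl])
  qed
  have "\<theta> \<in> pos_span S" using g(4)[OF t] g(3)[OF t] le'[OF t] by auto
  have mem: "rt \<alpha> k \<in> pos_span ?S \<longleftrightarrow> h (rt \<alpha> k) > 0" if a: "\<alpha> \<in> \<Phi>" for \<alpha> k
  proof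
    assume "rt \<alpha> k \<in> pos_span ?S"
    then show "h (rt \<alpha> k) > 0" using h_nonneg[of "rt \<alpha> k"] h_rt_pos_iff(2)[OF a, of k] by simp
  next
    assume "h (rt \<alpha> k) > 0"
    then consider "k = 0" "g \<alpha> > 0" | "k \<ge> 1" using h_rt_pos_iff(1)[OF a, of k] hP[OF a] by auto
    then show "rt \<alpha> k \<in> pos_span ?S"
    proof cases
      case 1
      then show ?thesis using g(4)[OF a] up by (simp add: rt_def)
    next
      case 2
      \<comment> \<open>Of the \<open>k\<close> copies of \<theta> that make up for k(\<delta> -
        \<theta>), one is joined to \<alpha>: \<theta> + \<alpha> lies in the cone because -\<alpha>
        is a root and \<theta> is highest.\<close>
      have "rt \<alpha> k = of_int k *\<^sub>R (\<delta> - \<theta>) + (of_int (k - 1) *\<^sub>R \<theta> + (\<theta> - (- \<alpha>)))"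
        by (simp add: rt_def algebra_simps)
      moreover have "of_int k *\<^sub>R (\<delta> - \<theta>) \<in> pos_span ?S"
        by (intro pos_span_scale pos_span_superset finS) (use 2 in auto)
      moreover have "of_int (k - 1) *\<^sub>R \<theta> \<in> pos_span ?S"
        by (intro pos_span_scale finS up) (use 2 \<open>\<theta> \<in> pos_span S\<close> in auto)
      moreover have "\<theta> - (- \<alpha>) \<in> pos_span ?S" using up hi um[OF a] by blast
      ultimately show ?thesis using pos_span_add[OF finS] by metis
    qed
  qed
  have "affine_system.P \<Phi> \<delta> h = P"
    unfolding P P_def aff_def using mem unfolding rt_def by blast
  then show ?thesis using that affine_system_axioms by blast
qed

section \<open>Finite and affine type together\<close>

lemma positive_roots_add_or_remove_root:
  fixes P :: "'v::euclidean_space set"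
  assumes P: "finite_positive_roots P \<or> affine_positive_roots P"
    and B: "biclosed P B1" "biclosed P B2" "B1 \<subset> B2"
  shows "\<exists>y\<in>B2 - B1. biclosed P (insert y B1) \<or> biclosed P (B2 - {y})"
  using P
proof
  assume "finite_positive_roots P"
  then obtain \<Phi> S where R: "finite_root_system \<Phi>" and S: "is_base \<Phi> S" and PS: "P = \<Phi> \<inter> pos_span S"
    unfolding finite_positive_roots_def by blast
  obtain h :: "'v \<Rightarrow> real" where h: "linear h" "\<And>\<alpha>. \<alpha> \<in> \<Phi> \<Longrightarrow> h \<alpha> \<in> \<int> \<and> h \<alpha> \<noteq> 0"
    "\<And>\<alpha>. \<alpha> \<in> \<Phi> \<Longrightarrow> \<alpha> \<in> pos_span S \<longleftrightarrow> h \<alpha> > 0"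
    using base_height[OF R S] by metis
  interpret crystal \<Phi> "\<lambda>x. x" by (rule finite_root_system_crystal[OF R])
  have Ph: "P = pos h" unfolding PS pos_def using h(3) by auto
  have "height h" unfolding height_def using h by auto
  moreover have "finite B1"
    using biclosed_subset[OF B(1)] PS finite_root_systemD(1)[OF R] by (meson finite_Int finite_subset)
  ultimately show ?thesis using add_root_to_finite[of B1 h B2] B unfolding Ph by blast
next
  assume "affine_positive_roots P"
  then obtain \<Phi> \<delta> p h where a: "affine_system \<Phi> \<delta> p h" "affine_system.P \<Phi> \<delta> h = P"
    using affine_positive_roots_system by blast
  show ?thesis using affine_system.add_or_remove_root[OF a(1)] B unfolding a(2) by blast
qed

theorem theoremD:
  fixes P :: "'v::euclidean_space set" and C :: "'v set set"
  assumes "finite_positive_roots P \<or> affine_positive_roots P"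
    and "max_chain_ext_weak P C"
  shows "\<exists>!R. R \<subseteq> P \<times> P \<and> linear_order_on P R \<and> C = initial_segments P R"
proof (rule maxchain_total_order[OF assms(2)])
  fix B1 B2 :: "'v set" and x y
  assume B: "biclosed P B1" "biclosed P B2" "B1 \<subseteq> B2" and xy: "x \<in> B2 - B1" "y \<in> B2 - B1" "x \<noteq> y"
  then obtain z where z: "z \<in> B2 - B1" "biclosed P (insert z B1) \<or> biclosed P (B2 - {z})"
    using positive_roots_add_or_remove_root[OF assms(1) B(1,2)] by blast
  \<comment> \<open>Two roots lie in \<open>B2 - B1\<close>, so adding or removing one of its roots
    leaves both inclusions strict.\<close>
  then show "\<exists>B. biclosed P B \<and> B1 \<subset> B \<and> B \<subset> B2"
  proof (elim disjE)
    assume "biclosed P (insert z B1)"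
    then show ?thesis using z(1) xy B(3) by (intro exI[of _ "insert z B1"]) blast
  next
    assume "biclosed P (B2 - {z})"
    then show ?thesis using z(1) xy B(3) by (intro exI[of _ "B2 - {z}"]) blast
  qed
qed

end
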